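(* Let $n$ be an integer. The number of signed partitions $\sigma=(\pi,\nu)$ of $n$, where (i) $\ell(\pi)$ is odd, and each positive part is even and $\geq \ell(\pi)-1$, and (ii) the negative parts are odd, less than $\ell(\pi)$, and may appear at most twice (that is, each value occurs at most twice among the negative parts), equals the number of (ordinary) partitions of $n$ into parts congruent to $\pm 2, \pm 4, \pm 5, \pm 6 \pmod{18}$.
   Context: A partition $\lambda$ of an integer $n$ into $\ell$ parts is an $\ell$-tuple $(\lambda_1,\dots,\lambda_\ell)$ of positive integers (its parts) with $\lambda_i\geq\lambda_{i+1}$ for $1\le i\le \ell-1$ and $\sum_{i=1}^{\ell}\lambda_i=n$. The number of parts $\ell=\ell(\lambda)$ is the length of $\lambda$, and the sum of its parts is its weight, denoted $|\lambda|$. The empty partition (length $0$, weight $0$) is allowed. A signed partition $\sigma$ of an integer $n$ is a pair $(\pi,\nu)$ of partitions with $n=|\pi|-|\nu|$; the parts of $\pi$ are called the positive parts of $\sigma$ and the parts of $\nu$ (which are themselves positive integers) are called the negative parts of $\sigma$.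
   Formalization: The integer n is assumed nonzero: at n = 0 the empty partition is the one ordinary partition, while no signed partition of 0 satisfies (i) and (ii), since ℓ(π) is odd, so π is nonempty and |π| > |ν|. *)

theory Defs
  imports Main "HOL-Number_Theory.Cong"
begin

text \<open>
  A partition is the weakly decreasing list of its (positive) parts; its length is
  \<^const>\<open>length\<close>, its weight is \<^const>\<open>sum_list\<close>. The empty list is the empty partition.
\<close>

definition is_partition :: "nat list \<Rightarrow> bool" where
  "is_partition xs \<longleftrightarrow> sorted_wrt (\<ge>) xs \<and> (\<forall>p\<in>set xs. 0 < p)"

definition partition_of :: "nat list \<Rightarrow> int \<Rightarrow> bool" where
  "partition_of xs n \<longleftrightarrow> is_partition xs \<and> int (sum_list xs) = n"

definition signed_partition_of :: "nat list \<times> nat list \<Rightarrow> int \<Rightarrow> bool" where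
  "signed_partition_of \<sigma> n \<longleftrightarrow>
     is_partition (fst \<sigma>) \<and> is_partition (snd \<sigma>) \<and>
     n = int (sum_list (fst \<sigma>)) - int (sum_list (snd \<sigma>))"

definition restricted_signed_partitions :: "int \<Rightarrow> (nat list \<times> nat list) set" where
  "restricted_signed_partitions n = {(\<pi>, \<nu>). signed_partition_of (\<pi>, \<nu>) n \<and>
     odd (length \<pi>) \<and> (\<forall>p\<in>set \<pi>. even p \<and> p \<ge> length \<pi> - 1) \<and>
     (\<forall>m\<in>set \<nu>. odd m \<and> m < length \<pi> \<and> count_list \<nu> m \<le> 2)}"

definition restricted_partitions_mod18 :: "int \<Rightarrow> nat list set" where
  "restricted_partitions_mod18 n = {\<mu>. partition_of \<mu> n \<and>
     (\<forall>p\<in>set \<mu>. \<exists>r\<in>{2, 4, 5, 6}. [int p = r] (mod 18) \<or> [int p = - r] (mod 18))}"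

text \<open>
  Both sets are finite, so \<^const>\<open>card\<close> really counts their elements.
\<close>

lemma length_le_sum_list:
  fixes xs :: "nat list"
  assumes "\<forall>p\<in>set xs. c \<le> p"
  shows "length xs * c \<le> sum_list xs"
  using assms by (induction xs) auto

lemma finite_lists_sum_list_le:
  "finite {xs :: nat list. (\<forall>p\<in>set xs. 0 < p) \<and> sum_list xs \<le> N}"
proof (rule finite_subset)
  show "{xs :: nat list. (\<forall>p\<in>set xs. 0 < p) \<and> sum_list xs \<le> N}
      \<subseteq> {xs. set xs \<subseteq> {..N} \<and> length xs \<le> N}"
  proof clarify
    fix xs :: "nat list"
    assume pos: "\<forall>p\<in>set xs. 0 < p" and le: "sum_list xs \<le> N"
    have "length xs * 1 \<le> sum_list xs"
      using pos by (intro length_le_sum_list) (auto simp: Suc_le_eq)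
    then show "set xs \<subseteq> {..N} \<and> length xs \<le> N"
      using le member_le_sum_list[of _ xs] by (auto intro: order_trans)
  qed
qed (simp add: finite_lists_length_le)

lemma finite_restricted_partitions_mod18: "finite (restricted_partitions_mod18 n)"
  by (rule finite_subset[OF _ finite_lists_sum_list_le[of "nat n"]])
    (auto simp: restricted_partitions_mod18_def partition_of_def is_partition_def)

lemma sum_odd_less: "\<Sum>{m. odd m \<and> m < 2 * j + 1} = j\<^sup>2" for j :: nat
proof (induction j)
  case (Suc j)
  have "{m. odd m \<and> m < 2 * Suc j + 1} = insert (2 * j + 1) {m. odd m \<and> m < 2 * j + 1}"
    by (auto simp: less_Suc_eq)
  then show ?case using Suc by (simp add: power2_eq_square)
qed simp

lemma sum_negative_parts_le:
  fixes \<nu> :: "nat list"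
  assumes "\<forall>m\<in>set \<nu>. odd m \<and> m < 2 * j + 1 \<and> count_list \<nu> m \<le> 2"
  shows "sum_list \<nu> \<le> 2 * j\<^sup>2"
proof -
  have "sum_list \<nu> = (\<Sum>m\<in>set \<nu>. count_list \<nu> m * m)"
    using sum_list_map_eq_sum_count[of "\<lambda>x. x" \<nu>] by simp
  also have "\<dots> \<le> (\<Sum>m\<in>set \<nu>. 2 * m)"
    using assms by (intro sum_mono) auto
  also have "\<dots> \<le> (\<Sum>m\<in>{m. odd m \<and> m < 2 * j + 1}. 2 * m)"
    using assms by (intro sum_mono2) auto
  also have "\<dots> = 2 * j\<^sup>2"
    using sum_odd_less[of j] by (simp only: sum_distrib_left[symmetric])
  finally show ?thesis .
qed

lemma finite_restricted_signed_partitions: "finite (restricted_signed_partitions n)"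
proof -
  define N where "N = nat n"
  define P where "P M = {xs :: nat list. (\<forall>p\<in>set xs. 0 < p) \<and> sum_list xs \<le> M}" for M
  have "restricted_signed_partitions n \<subseteq> P (N + 2 * N\<^sup>2) \<times> P (2 * N\<^sup>2)"
  proof clarify
    fix \<pi> \<nu> assume "(\<pi>, \<nu>) \<in> restricted_signed_partitions n"
    then have pos: "\<forall>p\<in>set \<pi>. 0 < p" "\<forall>p\<in>set \<nu>. 0 < p"
      and eq: "n = int (sum_list \<pi>) - int (sum_list \<nu>)"
      and odd: "odd (length \<pi>)" and ge: "\<forall>p\<in>set \<pi>. length \<pi> - 1 \<le> p"
      and neg: "\<forall>m\<in>set \<nu>. odd m \<and> m < length \<pi> \<and> count_list \<nu> m \<le> 2"
      by (auto simp: restricted_signed_partitions_def signed_partition_of_def is_partition_def)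
    obtain j where j: "length \<pi> = 2 * j + 1" using odd by (auto elim: oddE)
    have nu: "sum_list \<nu> \<le> 2 * j\<^sup>2"
      using neg j by (intro sum_negative_parts_le) auto
    have "(2 * j + 1) * (2 * j) \<le> sum_list \<pi>"
      using length_le_sum_list[OF ge] j by simp
    with nu have "sum_list \<nu> + j \<le> sum_list \<pi>"
      by (simp add: power2_eq_square algebra_simps)
    with eq have "j \<le> N" by (simp add: N_def)
    then have "2 * j\<^sup>2 \<le> 2 * N\<^sup>2" by simp
    with nu have nu': "sum_list \<nu> \<le> 2 * N\<^sup>2" by linarith
    moreover have "sum_list \<pi> \<le> N + sum_list \<nu>" using eq by (simp add: N_def)
    ultimately show "\<pi> \<in> P (N + 2 * N\<^sup>2) \<and> \<nu> \<in> P (2 * N\<^sup>2)"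
      using pos by (simp add: P_def)
  qed
  then show ?thesis
    unfolding P_def
    by (rule finite_subset[OF _ finite_cartesian_product[OF finite_lists_sum_list_le finite_lists_sum_list_le]])
qed

text \<open>
  At \<open>n = 0\<close> the two counts differ: the empty partition is counted on the one side, but on
  the other the length of \<open>\<pi>\<close> is odd, hence \<open>\<pi>\<close> is nonempty, and its weight strictly exceeds
  that of \<open>\<nu>\<close>.
\<close>

lemma restricted_signed_partitions_0: "restricted_signed_partitions 0 = {}"
proof (rule equals0I, clarify)
  fix \<pi> \<nu> assume "(\<pi>, \<nu>) \<in> restricted_signed_partitions 0"
  then have pos: "\<forall>p\<in>set \<pi>. 0 < p"
    and eq: "sum_list \<pi> = sum_list \<nu>"
    and odd: "odd (length \<pi>)" and ge: "\<forall>p\<in>set \<pi>. length \<pi> - 1 \<le> p"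
    and neg: "\<forall>m\<in>set \<nu>. odd m \<and> m < length \<pi> \<and> count_list \<nu> m \<le> 2"
    by (auto simp: restricted_signed_partitions_def signed_partition_of_def is_partition_def)
  obtain j where j: "length \<pi> = 2 * j + 1" using odd by (auto elim: oddE)
  have nu: "sum_list \<nu> \<le> 2 * j\<^sup>2"
    using neg j by (intro sum_negative_parts_le) auto
  have "(2 * j + 1) * (2 * j) \<le> sum_list \<pi>"
    using length_le_sum_list[OF ge] j by simp
  with nu eq have "j = 0"
    by (simp add: power2_eq_square algebra_simps)
  have "length \<pi> * 1 \<le> sum_list \<pi>"
    using pos by (intro length_le_sum_list) (auto simp: Suc_le_eq)
  moreover have "sum_list \<nu> = 0" using nu \<open>j = 0\<close> by simp
  ultimately show False using eq j by linarith
qed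

lemma restricted_partitions_mod18_0: "restricted_partitions_mod18 0 = {[]}"
proof -
  have "xs = []" if "\<forall>p\<in>set xs. 0 < p" "sum_list xs = 0" for xs :: "nat list"
    using that by (cases xs) auto
  then show ?thesis
    by (auto simp: restricted_partitions_mod18_def partition_of_def is_partition_def)
qed

lemma counts_differ_at_0:
  "card (restricted_signed_partitions 0) \<noteq> card (restricted_partitions_mod18 0)"
  by (simp add: restricted_signed_partitions_0 restricted_partitions_mod18_0)

end

theory Submission
  imports Defs "HOL-Analysis.Analysis"
begin

text \<open>
  Both counts are read off from power series in a real variable \<open>q\<close> with \<open>0 < q < 1\<close>.
  Below, \<open>(a; x)_n\<close> is the product of \<open>1 - a x^i\<close> over \<open>i < n\<close>, and \<open>n\<close> may be infinite.

  Let \<open>\<pi>\<close> have \<open>2k + 1\<close> parts. Subtracting \<open>2k\<close> from each part and halving leaves an arbitrary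
  weakly decreasing list of \<open>2k + 1\<close> natural numbers, so \<open>\<pi>\<close> contributes
  \<open>q^(2k(2k+1)) / (q^2; q^2)_(2k+1)\<close>, while the negative parts \<open>1, 3, ..., 2k - 1\<close> contribute the
  product of \<open>1 + q^-(2i+1) + q^-(4i+2)\<close> over \<open>i < k\<close>. After clearing negative powers, the signed
  partitions have the generating function
  \<open>\<Sum>k. q^(2k(k+1)) (\<Prod>i<k. 1 + q^(2i+1) + q^(4i+2)) / (q^2; q^2)_(2k+1)\<close>.
  Its term \<open>k = 0\<close> also counts the pair of the list \<open>[0]\<close> with the empty partition, which is not
  a signed partition since \<open>0\<close> is not a positive part. This extra object has weight \<open>0\<close>, which is
  the reason for excluding \<open>n = 0\<close>.

  This series is evaluated by a Bailey pair. A finite form of Jacobi's triple product (at a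
  primitive root of unity of order 6) expands the \<open>k\<close>-th product divided by \<open>(q^2; q^2)_(2k+1)\<close> as
  \<open>\<Sum>s. e_s q^(s^2) / ((q^2; q^2)_(k-s) (q^2; q^2)_(k+s+1))\<close> over all integers \<open>s\<close>, where \<open>e\<close> runs
  periodically through \<open>1, 1, 0, -1, -1, 0\<close> (lemma \<open>finite_triple_product_odd\<close>). Summing over \<open>k\<close>
  first is Cauchy's Durfee rectangle identity (\<open>cauchy_durfee\<close>) and leaves
  \<open>(\<Sum>s. e_s q^(3s^2+2s)) / (q^2; q^2)_\<infinity>\<close> (\<open>cubic_bailey_sum\<close>).

  The remaining theta series is an instance of the quintuple product. It is turned into an
  infinite product by multiplying two triple product series and splitting the lattice of index
  pairs \<open>(i, j)\<close> by \<open>i - j\<close> modulo \<open>3\<close>: on each coset the form \<open>i^2 + 2j^2\<close> becomes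
  \<open>3s^2 + 6k^2\<close> up to linear terms, so the double series factors. One coset cancels, and the two
  others share a factor, which is again a triple product (\<open>quintuple_product_series\<close>). Collecting
  factors by residue classes gives the product of \<open>1 / (1 - q^m)\<close> over all \<open>m\<close> congruent to one
  of \<open>2, 4, 5, 6, 12, 13, 14, 16\<close> modulo \<open>18\<close> (\<open>quintuple_eq_qprod\<close>), which is the
  generating function of the partitions on the other side.
\<close>

section \<open>Infinite sums and power series\<close>

lemma has_sum_shift_int:
  fixes f :: "int \<Rightarrow> 'a :: {topological_comm_monoid_add, t2_space}"
  assumes "(f has_sum s) UNIV"
  shows "((\<lambda>j. f (j + c)) has_sum s) UNIV"
proof -
  have "bij (\<lambda>j. j + c)" by (rule bijI') (auto intro: exI[of _ "_ - c"])
  then show ?thesis using assms has_sum_reindex_bij_betw[of "\<lambda>j. j + c" UNIV UNIV f s] by simp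
qed

lemma has_sum_uminus_int:
  fixes f :: "int \<Rightarrow> 'a :: {topological_comm_monoid_add, t2_space}"
  assumes "(f has_sum s) UNIV"
  shows "((\<lambda>j. f (- j)) has_sum s) UNIV"
proof -
  have "bij (\<lambda>j::int. - j)" by (rule bijI') (auto intro: exI[of _ "- _"])
  then show ?thesis using assms has_sum_reindex_bij_betw[of "\<lambda>j. - j" UNIV UNIV f s] by simp
qed

lemma has_sum_int_nat:
  fixes f :: "int \<Rightarrow> real"
  assumes "(f has_sum a) UNIV" "\<And>n. n < 0 \<Longrightarrow> f n = 0"
  shows "((\<lambda>n. f (int n)) has_sum a) UNIV"
proof -
  have "f x = 0" if "x \<notin> range int" for x
    using that by (cases x rule: int_cases2) (auto intro!: assms(2))
  then have "(f has_sum a) (range int)"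
    using assms(1) by (subst has_sum_cong_neutral[of UNIV "range int" f f]) auto
  then show ?thesis by (subst (asm) has_sum_reindex) (auto simp: o_def)
qed

lemma has_sum_product_real:
  fixes f :: "'a \<Rightarrow> real" and g :: "'b \<Rightarrow> real"
  assumes f: "(f has_sum a) A" and g: "(g has_sum b) B"
  shows "((\<lambda>(x, y). f x * g y) has_sum (a * b)) (A \<times> B)"
proof -
  have f': "(\<lambda>x. \<bar>f x\<bar>) summable_on A" and g': "(\<lambda>x. \<bar>g x\<bar>) summable_on B"
    using has_sum_imp_summable[OF f, THEN summable_on_iff_abs_summable_on_real[THEN iffD1]]
      has_sum_imp_summable[OF g, THEN summable_on_iff_abs_summable_on_real[THEN iffD1]]
    by simp_all
  have "(\<lambda>(x, y). \<bar>f x\<bar> * \<bar>g y\<bar>) summable_on (A \<times> B)"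
  proof (rule summable_on_SigmaI)
    show "((\<lambda>y. case (x, y) of (x, y) \<Rightarrow> \<bar>f x\<bar> * \<bar>g y\<bar>) has_sum (\<bar>f x\<bar> * infsum (\<lambda>y. \<bar>g y\<bar>) B)) B" for x
      using g' by (auto intro!: has_sum_cmult_right has_sum_infsum)
    show "(\<lambda>x. \<bar>f x\<bar> * infsum (\<lambda>y. \<bar>g y\<bar>) B) summable_on A"
      using f' by (rule summable_on_cmult_left)
  qed auto
  then have s: "(\<lambda>(x, y). f x * g y) summable_on (A \<times> B)"
    by (subst summable_on_iff_abs_summable_on_real) (simp add: case_prod_unfold abs_mult)
  show ?thesis
  proof (rule has_sum_SigmaI[OF _ _ s])
    show "((\<lambda>y. case (x, y) of (x, y) \<Rightarrow> f x * g y) has_sum (f x * b)) B" for x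
      using has_sum_cmult_right[OF g] by simp
    show "((\<lambda>x. f x * b) has_sum (a * b)) A"
      using has_sum_cmult_left[OF f] by simp
  qed
qed

text \<open>
  Tannery's theorem for series over the integers, reduced to the version for sequences by
  enumerating the integers.
\<close>

lemma tannery_int:
  fixes f :: "nat \<Rightarrow> int \<Rightarrow> real"
  assumes lim: "\<And>j. (\<lambda>n. f n j) \<longlonglongrightarrow> g j"
    and bound: "\<And>n j. \<bar>f n j\<bar> \<le> M j" and M: "M summable_on UNIV"
    and f: "\<And>n. (f n has_sum F n) UNIV" and g: "(g has_sum G) UNIV"
  shows "F \<longlonglongrightarrow> G"
proof -
  have bij: "bij int_decode" using inj_int_decode surj_int_decode by (auto simp: bij_def)
  have sums: "(\<lambda>k. h (int_decode k)) sums s" if "(h has_sum s) UNIV" for h :: "int \<Rightarrow> real" and s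
    using has_sum_reindex_bij_betw[OF bij, of h s] that by (auto intro: has_sum_imp_sums)
  have "summable (\<lambda>k. M (int_decode k))"
    using sums[of M "infsum M UNIV"] M by (auto simp: sums_iff)
  then have "(\<lambda>n. \<Sum>k. f n (int_decode k)) \<longlonglongrightarrow> (\<Sum>k. g (int_decode k))"
    using tannerys_theorem[of "\<lambda>k n. f n (int_decode k)" "\<lambda>k. g (int_decode k)" sequentially
        "\<lambda>k. M (int_decode k)"] lim bound by (simp add: always_eventually)
  moreover have "(\<Sum>k. f n (int_decode k)) = F n" for n
    using sums[OF f[of n]] by (simp add: sums_iff)
  moreover have "(\<Sum>k. g (int_decode k)) = G"
    using sums[OF g] by (simp add: sums_iff)
  ultimately show ?thesis by simp
qed

text \<open>
  For nonnegative terms every finite subset of the union already lies in some \<open>B n\<close>, so the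
  supremum of the finite sums over the union is the limit of the \<open>V n\<close>. This is what passes from
  partitions with bounded parts to all partitions.
\<close>

lemma has_sum_increasing_Union:
  fixes f :: "'a \<Rightarrow> real"
  assumes nonneg: "\<And>x. 0 \<le> f x" and B: "\<And>n. (f has_sum V n) (B n)" and mono: "incseq B"
    and lim: "V \<longlonglongrightarrow> L"
  shows "(f has_sum L) (\<Union>n. B n)"
proof -
  have VL: "V n \<le> L" for n
  proof -
    have "incseq V"
    proof (rule incseq_SucI)
      fix n show "V n \<le> V (Suc n)"
        by (rule has_sum_mono2[OF B B]) (use mono nonneg in \<open>auto simp: incseq_Suc_iff\<close>)
    qed
    then show ?thesis using lim by (rule incseq_le)
  qed
  have fin: "sum f F \<le> L" if "finite F" "F \<subseteq> (\<Union>n. B n)" for F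
  proof -
    have "\<exists>n. F \<subseteq> B n" using that
    proof (induction F rule: finite_induct)
      case (insert x F)
      then obtain n m where "F \<subseteq> B n" "x \<in> B m" by auto
      moreover have "B n \<subseteq> B (max n m)" "B m \<subseteq> B (max n m)" using mono by (auto simp: mono_def)
      ultimately show ?case by (intro exI[of _ "max n m"]) auto
    qed simp
    then obtain n where "F \<subseteq> B n" ..
    then have "sum f F \<le> V n" using B nonneg that(1) by (intro finite_sum_le_has_sum[OF B]) auto
    with VL[of n] show ?thesis by linarith
  qed
  have sm: "f summable_on (\<Union>n. B n)"
    by (rule nonneg_bdd_above_summable_on) (use nonneg fin in \<open>auto intro!: bdd_aboveI[of _ L]\<close>)
  have "infsum f (\<Union>n. B n) \<le> L" by (rule infsum_le_finite_sums[OF sm fin])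
  moreover have "V n \<le> infsum f (\<Union>n. B n)" for n
    by (rule has_sum_mono2[OF B has_sum_infsum[OF sm]]) (use nonneg in auto)
  then have "L \<le> infsum f (\<Union>n. B n)" using lim by (intro LIMSEQ_le_const2) auto
  ultimately have "infsum f (\<Union>n. B n) = L" by (rule antisym)
  then show ?thesis using has_sum_infsum[OF sm] by (simp only:)
qed

text \<open>
  Removing the common lower coefficients and dividing by a power of \<open>q\<close> leaves a power series that
  vanishes on \<open>(0, 1)\<close>; its constant term is then \<open>0\<close> by continuity from the right.
\<close>

lemma powser_coeffs_unique:
  fixes a b :: "nat \<Rightarrow> real"
  assumes a: "\<And>q. 0 < q \<Longrightarrow> q < 1 \<Longrightarrow> (\<lambda>n. a n * q ^ n) sums V q"
    and b: "\<And>q. 0 < q \<Longrightarrow> q < 1 \<Longrightarrow> (\<lambda>n. b n * q ^ n) sums V q"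
  shows "a n = b n"
proof (induction n rule: less_induct)
  case (less n)
  define d where "d k = a (k + n) - b (k + n)" for k
  have sums: "(\<lambda>k. d k * q ^ k) sums 0" if q: "0 < q" "q < 1" for q
  proof -
    have "(\<lambda>k. a k * q ^ k - b k * q ^ k) sums (V q - V q)"
      using a[OF q] b[OF q] by (rule sums_diff)
    then have "(\<lambda>k. a (k + n) * q ^ (k + n) - b (k + n) * q ^ (k + n)) sums
        (V q - V q - (\<Sum>k<n. a k * q ^ k - b k * q ^ k))"
      by (rule sums_split_initial_segment)
    moreover have "(\<Sum>k<n. a k * q ^ k - b k * q ^ k) = 0"
      using less by (intro sum.neutral) auto
    ultimately have "(\<lambda>k. (d k * q ^ k) * q ^ n) sums (0 * q ^ n)"
      by (simp add: d_def algebra_simps power_add)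
    then show ?thesis using q by (subst (asm) sums_mult2_iff) auto
  qed
  have "summable (\<lambda>k. d k * (1/2) ^ k)" using sums[of "1/2"] by (auto simp: sums_iff)
  then have "isCont (\<lambda>x. \<Sum>k. d k * x ^ k) 0"
    by (rule isCont_powser) simp
  then have "((\<lambda>x. \<Sum>k. d k * x ^ k) \<longlongrightarrow> d 0) (at_right 0)"
    by (auto simp: isCont_def intro: tendsto_mono[OF at_le])
  moreover have "\<forall>\<^sub>F x in at_right 0. (\<Sum>k. d k * x ^ k) = 0"
    unfolding eventually_at_right_field using sums by (auto intro!: exI[of _ 1] simp: sums_iff)
  ultimately have "((\<lambda>x::real. 0) \<longlongrightarrow> d 0) (at_right 0)"
    by (rule Lim_transform_eventually)
  then have "d 0 = 0" by (simp add: tendsto_const_iff)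
  then show ?case by (simp add: d_def)
qed

text \<open>
  Grouping a sum of \<open>q ^ w x\<close> by the weight \<open>w x\<close> turns it into the generating function of the
  fibres. The fibres are finite because infinitely many copies of \<open>q ^ n\<close> are not summable.
\<close>

lemma has_sum_fibres_powser:
  fixes w :: "'a \<Rightarrow> nat" and q :: real
  assumes sum: "((\<lambda>x. q ^ w x) has_sum V) A" and q: "0 < q"
  shows "(\<lambda>n. real (card {x \<in> A. w x = n}) * q ^ n) sums V"
proof -
  have fin: "finite {x \<in> A. w x = n}" for n
  proof (rule ccontr)
    assume "infinite {x \<in> A. w x = n}"
    then have "\<not> (\<lambda>_. q ^ n) summable_on {x \<in> A. w x = n}"
      using q by (intro infsum_diverge_constant) auto
    moreover have "(\<lambda>x. q ^ w x) summable_on {x \<in> A. w x = n}"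
      by (rule summable_on_subset_banach[OF has_sum_imp_summable[OF sum]]) auto
    then have "(\<lambda>_. q ^ n) summable_on {x \<in> A. w x = n}"
      by (rule summable_on_cong[THEN iffD1, rotated]) simp
    ultimately show False by blast
  qed
  have "((\<lambda>(n, x). q ^ n) has_sum V) (SIGMA n:UNIV. {x \<in> A. w x = n}) \<longleftrightarrow> ((\<lambda>x. q ^ w x) has_sum V) A"
    by (rule has_sum_reindex_bij_witness[where i = "\<lambda>x. (w x, x)" and j = snd]) auto
  then have "((\<lambda>(n, x). q ^ n) has_sum V) (SIGMA n:UNIV. {x \<in> A. w x = n})" using sum by simp
  then have "((\<lambda>n. real (card {x \<in> A. w x = n}) * q ^ n) has_sum V) UNIV"
    by (rule has_sum_SigmaD) (auto intro!: has_sum_finiteI fin)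
  then show ?thesis by (rule has_sum_imp_sums)
qed

section \<open>Reciprocals of q-factorials\<close>

text \<open>
  The reciprocal of \<open>(q; q)_m\<close>. The index is an integer and the value is \<open>0\<close> for negative \<open>m\<close>, the
  usual convention for \<open>1 / m!\<close>; the recurrence \<open>inv_qfact_pred\<close> then holds for all integers, and
  all sums below may range over all integers without boundary terms.
\<close>

definition inv_qfact :: "real \<Rightarrow> int \<Rightarrow> real" where
  "inv_qfact q m = (if m < 0 then 0 else (\<Prod>i=1..nat m. 1 / (1 - q ^ i)))"

lemma inv_qfact_neg [simp]: "m < 0 \<Longrightarrow> inv_qfact q m = 0"
  by (simp add: inv_qfact_def)

lemma inv_qfact_0 [simp]: "inv_qfact q 0 = 1"
  by (simp add: inv_qfact_def)

lemma inv_qfact_of_nat: "inv_qfact q (int n) = (\<Prod>i=1..n. 1 / (1 - q ^ i))"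
  by (simp add: inv_qfact_def)

lemma inv_qfact_pred:
  assumes q: "0 < q" "q < 1"
  shows "inv_qfact q (m - 1) = (1 - q powi m) * inv_qfact q m"
proof (cases "m \<le> 0")
  case True
  then show ?thesis by (cases "m = 0") auto
next
  case False
  define n where "n = nat (m - 1)"
  have m: "m = int (Suc n)" using False by (simp add: n_def)
  have "q ^ Suc n < 1" using q by (intro power_Suc_less_one) auto
  then have "1 - q ^ Suc n \<noteq> 0" by simp
  moreover have "inv_qfact q m = inv_qfact q (int n) * (1 / (1 - q ^ Suc n))"
    unfolding m inv_qfact_of_nat by simp
  moreover have "q powi m = q ^ Suc n" unfolding m power_int_of_nat ..
  moreover have "m - 1 = int n" using m by simp
  ultimately show ?thesis by simp
qed

lemma inv_qfact_nonneg:
  assumes q: "0 < q" "q < 1"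
  shows "0 \<le> inv_qfact q m"
  unfolding inv_qfact_def using q by (auto intro!: prod_nonneg simp: power_le_one)

text \<open>
  The reciprocal of \<open>(q; q)_\<infinity>\<close>.
\<close>

definition inv_qfact_inf :: "real \<Rightarrow> real" where
  "inv_qfact_inf q = lim (\<lambda>n. inv_qfact q (int n))"

text \<open>
  The sequence increases because \<open>0 < 1 - q ^ i < 1\<close>, and it converges because the infinite product
  of the \<open>1 - q ^ i\<close> is absolutely convergent, hence not \<open>0\<close>.
\<close>

lemma
  assumes q: "0 < q" "q < 1"
  shows tendsto_inv_qfact: "(\<lambda>n. inv_qfact q (int n)) \<longlonglongrightarrow> inv_qfact_inf q"
    and inv_qfact_le_inf: "inv_qfact q m \<le> inv_qfact_inf q"
    and inv_qfact_inf_pos: "0 < inv_qfact_inf q"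
proof -
  have ne: "1 - q ^ Suc i \<noteq> 0" for i
    using power_Suc_less_one[of q i] q by simp
  have "summable (\<lambda>i. norm ((1 - q ^ Suc i) - 1))"
    using q by (simp add: summable_mult)
  then have conv: "convergent_prod (\<lambda>i. 1 - q ^ Suc i)"
    by (intro abs_convergent_prod_imp_convergent_prod summable_imp_abs_convergent_prod)
  define L where "L = prodinf (\<lambda>i. 1 - q ^ Suc i)"
  have L: "L \<noteq> 0" unfolding L_def by (rule prodinf_nonzero[OF conv ne])
  have "(\<lambda>n. 1 / (\<Prod>i\<le>n. 1 - q ^ Suc i)) \<longlonglongrightarrow> 1 / L"
    using convergent_prod_LIMSEQ[OF conv] L unfolding L_def by (intro tendsto_divide) auto
  moreover have "1 / (\<Prod>i\<le>n. 1 - q ^ Suc i) = inv_qfact q (int (Suc n))" for n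
  proof -
    have "(\<Prod>i\<le>n. 1 - q ^ Suc i) = (\<Prod>i=1..Suc n. 1 - q ^ i)"
      by (rule prod.reindex_bij_witness[of _ "\<lambda>i. i - 1" Suc]) auto
    then show ?thesis unfolding inv_qfact_of_nat by (simp only: prod_dividef prod.neutral_const)
  qed
  ultimately have "(\<lambda>n. inv_qfact q (int (Suc n))) \<longlonglongrightarrow> 1 / L" by simp
  then have lim: "(\<lambda>n. inv_qfact q (int n)) \<longlonglongrightarrow> 1 / L"
    by (rule LIMSEQ_imp_Suc)
  then have eq: "inv_qfact_inf q = 1 / L" unfolding inv_qfact_inf_def by (rule limI)
  show lim': "(\<lambda>n. inv_qfact q (int n)) \<longlonglongrightarrow> inv_qfact_inf q"
    using lim eq by simp
  have "incseq (\<lambda>n. inv_qfact q (int n))"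
  proof (rule incseq_SucI)
    fix n
    have "inv_qfact q (int n) = (1 - q ^ Suc n) * inv_qfact q (int (Suc n))"
      using inv_qfact_pred[OF q, of "int (Suc n)"] by (simp only: power_int_of_nat) simp
    also have "\<dots> \<le> 1 * inv_qfact q (int (Suc n))"
      using q inv_qfact_nonneg[OF q] by (intro mult_right_mono) auto
    finally show "inv_qfact q (int n) \<le> inv_qfact q (int (Suc n))" by simp
  qed
  then have le: "inv_qfact q (int n) \<le> inv_qfact_inf q" for n
    using incseq_le lim' by blast
  from le[of 0] show pos: "0 < inv_qfact_inf q" by simp
  show "inv_qfact q m \<le> inv_qfact_inf q"
    using le[of "nat m"] pos by (cases "m < 0") auto
qed

section \<open>Finite triple products\<close>

lemma powi_less_one:
  fixes q :: real
  assumes "0 < q" "q < 1" "0 < m"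
  shows "q powi m < 1"
proof -
  have "m = int (Suc (nat m - 1))" using assms(3) by simp
  then obtain n where "m = int (Suc n)" by blast
  then show ?thesis using assms power_Suc_less_one[of q n] by (simp only: power_int_of_nat)
qed

text \<open>
  Two steps of the Pascal recurrence for the q-binomial coefficient \<open>2n\<close> over \<open>n + j\<close>, divided by the
  q-factorial of \<open>2n\<close>. In terms of \<open>u\<close> and \<open>v\<close> as in the proof it is a rational identity.
\<close>

lemma inv_qfact_step:
  fixes n j :: int
  assumes q: "0 < q" "q < 1"
  shows "(1 - q powi (2 * n + 1)) * (1 - q powi (2 * n + 2)) *
           (inv_qfact q (n + 1 - j) * inv_qfact q (n + 1 + j)) =
         (1 + q powi (2 * n + 1)) * (inv_qfact q (n - j) * inv_qfact q (n + j)) +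
         q powi (n + 1 - j) * (inv_qfact q (n - (j - 1)) * inv_qfact q (n + (j - 1))) +
         q powi (n + 1 + j) * (inv_qfact q (n - (j + 1)) * inv_qfact q (n + (j + 1)))"
proof -
  define u v where "u = q powi (n + 1 - j)" and "v = q powi (n + 1 + j)"
  define a b where "a = inv_qfact q (n + 1 - j)" and "b = inv_qfact q (n + 1 + j)"
  have nz: "q \<noteq> 0" using q by simp
  have A: "inv_qfact q (n - j) = (1 - u) * a" "inv_qfact q (n + j) = (1 - v) * b"
    using inv_qfact_pred[OF q, of "n + 1 - j"] inv_qfact_pred[OF q, of "n + 1 + j"]
    by (simp_all add: u_def v_def a_def b_def)
  have uq: "q powi (n - j) = u / q" "q powi (n + j) = v / q"
    using nz power_int_diff[of q "n+1-j" 1] power_int_diff[of q "n+1+j" 1]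
    by (simp_all add: u_def v_def algebra_simps)
  have B: "inv_qfact q (n - (j + 1)) = (1 - u / q) * (1 - u) * a"
          "inv_qfact q (n + (j - 1)) = (1 - v / q) * (1 - v) * b"
    using inv_qfact_pred[OF q, of "n - j"] inv_qfact_pred[OF q, of "n + j"] A uq
    by (simp_all add: diff_diff_eq add_diff_eq)
  have C: "inv_qfact q (n - (j - 1)) = a" "inv_qfact q (n + (j + 1)) = b"
    by (simp_all add: a_def b_def algebra_simps)
  have uv: "q powi (2 * n + 2) = u * v" "q powi (2 * n + 1) = u * v / q"
    using nz power_int_add[of q "n+1-j" "n+1+j"] power_int_diff[of q "2*n+2" 1]
    by (simp_all add: u_def v_def algebra_simps)
  show ?thesis
    unfolding A B C uv u_def[symmetric] v_def[symmetric] a_def[symmetric] b_def[symmetric]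
    using nz by (simp add: field_simps)
qed

text \<open>
  For \<open>e j = z powi j\<close> and \<open>t = z + 1/z\<close> this is the finite form of Jacobi's triple product, since
  then \<open>1 + t x + x^2 = (1 + z x) (1 + x/z)\<close>. Only the recurrence of \<open>e\<close> matters, and it is linear
  and invariant under shifts: in the step from \<open>n\<close> to \<open>n + 1\<close>, \<open>inv_qfact_step\<close> produces the sums for
  \<open>n\<close> with \<open>e\<close> shifted by \<open>-1\<close>, \<open>0\<close> and \<open>1\<close>, to which the induction hypothesis applies.
  Working with \<open>e\<close> avoids complex roots of unity.
\<close>

lemma finite_triple_product:
  fixes p t :: real and e :: "int \<Rightarrow> real"
  assumes p: "0 < p" "p < 1" and e: "\<And>j. e (j - 1) + e (j + 1) = t * e j"
  shows "((\<lambda>j. e j * p powi (j\<^sup>2) * (inv_qfact (p\<^sup>2) (int n - j) * inv_qfact (p\<^sup>2) (int n + j)))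
          has_sum (e 0 * (\<Prod>i<n. 1 + t * p ^ (2 * i + 1) + p ^ (4 * i + 2)) *
                   inv_qfact (p\<^sup>2) (2 * int n))) UNIV"
  using e
proof (induction n arbitrary: e)
  case 0
  show ?case
    proof (rule has_sum_finite_neutralI[of "{0}"])
    fix j :: int assume "j \<in> UNIV - {0}"
    then have "j < 0 \<or> - j < 0" by auto
    then show "e j * p powi (j\<^sup>2) * (inv_qfact (p\<^sup>2) (int 0 - j) * inv_qfact (p\<^sup>2) (int 0 + j)) = 0"
      by auto
  qed auto
next
  case (Suc n)
  define q where "q = p\<^sup>2"
  have q: "0 < q" "q < 1" using p by (auto simp: q_def power_less_one_iff)
  have qpow: "q powi k = p powi (2 * k)" for k
    by (simp add: q_def power_int_mult)
  define X where "X j = p powi (j\<^sup>2) * (inv_qfact q (int n - j) * inv_qfact q (int n + j))" for j :: int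
  define P where "P = (\<Prod>i<n. 1 + t * p ^ (2 * i + 1) + p ^ (4 * i + 2)) * inv_qfact q (2 * int n)"
  define c where "c = (1 - q powi (2 * n + 1)) * (1 - q powi (2 * n + 2))"
  have IH: "((\<lambda>j. e' j * X j) has_sum (e' 0 * P)) UNIV"
    if "\<And>j. e' (j - 1) + e' (j + 1) = t * e' j" for e'
    using Suc.IH[OF that] by (simp add: X_def P_def q_def mult_ac)
  have "q powi (2 * int n + 1) < 1" "q powi (2 * int n + 2) < 1"
    using q by (auto intro!: powi_less_one)
  then have c: "c \<noteq> 0" by (auto simp: c_def add.commute)
  have S0: "((\<lambda>j. e j * X j) has_sum (e 0 * P)) UNIV"
    by (rule IH) (rule Suc.prems)
  have "((\<lambda>j. e (j + 1) * X j) has_sum (e (0 + 1) * P)) UNIV"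
    using IH[of "\<lambda>j. e (j + 1)"] Suc.prems[of "_ + 1"] by (simp add: algebra_simps)
  from has_sum_shift_int[OF this, of "-1"]
  have S1: "((\<lambda>j. e j * X (j - 1)) has_sum (e 1 * P)) UNIV" by simp
  have "((\<lambda>j. e (j - 1) * X j) has_sum (e (0 - 1) * P)) UNIV"
    using IH[of "\<lambda>j. e (j - 1)"] Suc.prems[of "_ - 1"] by (simp add: algebra_simps)
  from has_sum_shift_int[OF this, of "1"]
  have S2: "((\<lambda>j. e j * X (j + 1)) has_sum (e (-1) * P)) UNIV" by simp
  have S: "((\<lambda>j. (1 + q powi (2 * n + 1)) / c * (e j * X j) + (p ^ (2 * n + 1) / c * (e j * X (j - 1)) +
                 p ^ (2 * n + 1) / c * (e j * X (j + 1)))) has_sum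
             ((1 + q powi (2 * n + 1)) / c * (e 0 * P) + (p ^ (2 * n + 1) / c * (e 1 * P) +
                 p ^ (2 * n + 1) / c * (e (-1) * P)))) UNIV"
    by (intro has_sum_add has_sum_cmult_right S0 S1 S2)
  \<comment> \<open>The factors of inv_qfact_step become powers of p after completing the square.\<close>
  have term_eq: "e j * p powi (j\<^sup>2) * (inv_qfact q (int (Suc n) - j) * inv_qfact q (int (Suc n) + j)) =
        (1 + q powi (2 * n + 1)) / c * (e j * X j) + (p ^ (2 * n + 1) / c * (e j * X (j - 1)) +
                 p ^ (2 * n + 1) / c * (e j * X (j + 1)))" for j
  proof -
    have p2: "p powi (j\<^sup>2) * q powi (int n + 1 - j) = p ^ (2 * n + 1) * p powi ((j - 1)\<^sup>2)"
      "p powi (j\<^sup>2) * q powi (int n + 1 + j) = p ^ (2 * n + 1) * p powi ((j + 1)\<^sup>2)"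
      using p unfolding qpow power_int_of_nat[symmetric]
      by (auto simp: power_int_add[symmetric] power2_eq_square algebra_simps simp del: power_int_of_nat)
    have "c * (p powi (j\<^sup>2) * (inv_qfact q (int (Suc n) - j) * inv_qfact q (int (Suc n) + j))) =
          p powi (j\<^sup>2) * (c * (inv_qfact q (int n + 1 - j) * inv_qfact q (int n + 1 + j)))"
      by (simp add: algebra_simps)
    also have "\<dots> = (1 + q powi (2 * n + 1)) * X j + (p powi (j\<^sup>2) * q powi (int n + 1 - j)) *
          (inv_qfact q (int n - (j - 1)) * inv_qfact q (int n + (j - 1))) +
          (p powi (j\<^sup>2) * q powi (int n + 1 + j)) * (inv_qfact q (int n - (j + 1)) * inv_qfact q (int n + (j + 1)))"
      using inv_qfact_step[OF q, of "int n" j] unfolding c_def X_def by (simp add: algebra_simps)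
    also have "\<dots> = (1 + q powi (2 * n + 1)) * X j + p ^ (2 * n + 1) * X (j - 1) + p ^ (2 * n + 1) * X (j + 1)"
      unfolding p2 X_def by (simp only: mult.assoc)
    finally have "p powi (j\<^sup>2) * (inv_qfact q (int (Suc n) - j) * inv_qfact q (int (Suc n) + j)) =
      ((1 + q powi (2 * n + 1)) * X j + p ^ (2 * n + 1) * X (j - 1) + p ^ (2 * n + 1) * X (j + 1)) / c"
      using c by (simp add: field_simps)
    then show ?thesis using c by (simp only: mult.assoc) (simp add: field_simps)
  qed
  have "inv_qfact q (2 * int n) = c * inv_qfact q (2 * int (Suc n))"
    using inv_qfact_pred[OF q, of "2 * int n + 1"] inv_qfact_pred[OF q, of "2 * int n + 2"]
    by (simp add: c_def mult.assoc) (simp add: add.commute)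
  moreover have "1 + q powi (2 * n + 1) = 1 + p ^ (4 * n + 2)"
    unfolding qpow power_int_of_nat[symmetric] by (simp del: power_int_of_nat)
  moreover define K z r where "K = (\<Prod>i<n. 1 + t * p ^ (2 * i + 1) + p ^ (4 * i + 2))"
    and "z = p ^ (2 * n + 1)" and "r = inv_qfact q (2 * int (Suc n))"
  ultimately have "(1 + q powi (2 * n + 1)) / c * (e 0 * P) + (z / c * (e 1 * P) + z / c * (e (-1) * P)) =
      (1 + p ^ (4 * n + 2)) * e 0 * K * r + z * (e 1 + e (-1)) * K * r"
    using c unfolding P_def by (simp add: field_simps)
  also have "e 1 + e (-1) = t * e 0" using Suc.prems[of 0] by simp
  also have "(1 + p ^ (4 * n + 2)) * e 0 * K * r + z * (t * e 0) * K * r =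
      e 0 * (\<Prod>i<Suc n. 1 + t * p ^ (2 * i + 1) + p ^ (4 * i + 2)) * r"
    unfolding K_def z_def by (simp add: algebra_simps)
  finally have "(1 + q powi (2 * n + 1)) / c * (e 0 * P) + (p ^ (2 * n + 1) / c * (e 1 * P) +
                 p ^ (2 * n + 1) / c * (e (-1) * P)) =
      e 0 * (\<Prod>i<Suc n. 1 + t * p ^ (2 * i + 1) + p ^ (4 * i + 2)) * inv_qfact q (2 * int (Suc n))"
    unfolding z_def r_def .
  with S show ?case unfolding q_def[symmetric] term_eq by simp
qed

text \<open>
  The analogue for the q-binomial coefficient of odd order \<open>2n + 1\<close>. One Pascal step expresses it
  by the coefficients of order \<open>2n\<close> at \<open>j\<close> and \<open>j + 1\<close>; the second one leads to \<open>finite_triple_product\<close>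
  for the shifted sequence, whose value is a multiple of \<open>e (-1) = 0\<close>.
  In the language of Bailey pairs, this is a pair relative to \<open>a = p^2\<close>.
\<close>

lemma finite_triple_product_odd:
  fixes p t :: real and e :: "int \<Rightarrow> real"
  assumes p: "0 < p" "p < 1" and e: "\<And>j. e (j - 1) + e (j + 1) = t * e j" and e1: "e (-1) = 0"
  shows "((\<lambda>j. e j * p powi (j\<^sup>2) * (inv_qfact (p\<^sup>2) (int n - j) * inv_qfact (p\<^sup>2) (int n + j + 1)))
          has_sum (e 0 * (\<Prod>i<n. 1 + t * p ^ (2 * i + 1) + p ^ (4 * i + 2)) *
                   inv_qfact (p\<^sup>2) (2 * int n + 1))) UNIV"
proof -
  define q where "q = p\<^sup>2"
  have q: "0 < q" "q < 1" using p by (auto simp: q_def power_less_one_iff)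
  have qpow: "q powi k = p powi (2 * k)" for k
    by (simp add: q_def power_int_mult)
  define X where "X j = p powi (j\<^sup>2) * (inv_qfact q (int n - j) * inv_qfact q (int n + j))" for j :: int
  define P where "P = (\<Prod>i<n. 1 + t * p ^ (2 * i + 1) + p ^ (4 * i + 2)) * inv_qfact q (2 * int n)"
  define c where "c = 1 - q powi (2 * int n + 1)"
  have "q powi (2 * int n + 1) < 1"
    using q by (auto intro!: powi_less_one)
  then have c: "c \<noteq> 0" by (simp add: c_def)
  have S0: "((\<lambda>j. e j * X j) has_sum (e 0 * P)) UNIV"
    using finite_triple_product[OF p e, of n] by (simp add: X_def P_def q_def mult_ac)
  have "((\<lambda>j. e (j - 1) * X j) has_sum (e (0 - 1) * P)) UNIV"
    using finite_triple_product[OF p, of "\<lambda>j. e (j - 1)" t n] e[of "_ - 1"]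
    by (simp add: X_def P_def q_def algebra_simps)
  from has_sum_shift_int[OF this, of "1"]
  have S1: "((\<lambda>j. e j * X (j + 1)) has_sum 0) UNIV" using e1 by simp
  have S: "((\<lambda>j. 1 / c * (e j * X j) + p ^ (2 * n + 1) / c * (e j * X (j + 1))) has_sum
             (1 / c * (e 0 * P) + p ^ (2 * n + 1) / c * 0)) UNIV"
    by (intro has_sum_add has_sum_cmult_right S0 S1)
  have term_eq: "e j * p powi (j\<^sup>2) * (inv_qfact q (int n - j) * inv_qfact q (int n + j + 1)) =
        1 / c * (e j * X j) + p ^ (2 * n + 1) / c * (e j * X (j + 1))" for j
  proof -
    have p2: "p powi (j\<^sup>2) * q powi (int n + 1 + j) = p ^ (2 * n + 1) * p powi ((j + 1)\<^sup>2)"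
      using p unfolding qpow power_int_of_nat[symmetric]
      by (auto simp: power_int_add[symmetric] power2_eq_square algebra_simps simp del: power_int_of_nat)
    define a b where "a = inv_qfact q (int n - j)" and "b = inv_qfact q (int n + j + 1)"
    define u v where "u = q powi (int n - j)" and "v = q powi (int n + 1 + j)"
    have A: "inv_qfact q (int n - (j + 1)) = (1 - u) * a" "inv_qfact q (int n + j) = (1 - v) * b"
      using inv_qfact_pred[OF q, of "int n - j"] inv_qfact_pred[OF q, of "int n + j + 1"]
      by (simp_all add: u_def v_def a_def b_def algebra_simps)
    have uv: "c = 1 - u * v"
      using q power_int_add[of q "int n - j" "int n + 1 + j"] by (simp add: c_def u_def v_def algebra_simps)
    have "c * (p powi (j\<^sup>2) * (a * b)) = X j + p powi (j\<^sup>2) * v * ((1 - u) * a * b)"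
      unfolding uv X_def A a_def[symmetric] b_def[symmetric] by (simp add: algebra_simps)
    also have "\<dots> = X j + p ^ (2 * n + 1) * X (j + 1)"
      using p2 A unfolding X_def v_def a_def b_def by (simp add: add.assoc mult.assoc)
    finally have "p powi (j\<^sup>2) * (a * b) = (X j + p ^ (2 * n + 1) * X (j + 1)) / c"
      using c by (simp add: field_simps)
    then show ?thesis using c unfolding a_def b_def by (simp only: mult.assoc) (simp add: field_simps)
  qed
  have "inv_qfact q (2 * int n) = c * inv_qfact q (2 * int n + 1)"
    using inv_qfact_pred[OF q, of "2 * int n + 1"] by (simp add: c_def algebra_simps)
  then have "1 / c * (e 0 * P) + p ^ (2 * n + 1) / c * 0 =
     e 0 * (\<Prod>i<n. 1 + t * p ^ (2 * i + 1) + p ^ (4 * i + 2)) * inv_qfact q (2 * int n + 1)"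
    using c by (simp add: P_def)
  with S show ?thesis unfolding q_def[symmetric] term_eq by simp
qed

section \<open>Theta series and the triple product\<close>

text \<open>
  The square in the exponent dominates: by the ratio test on each half of the integers, any
  nonzero base \<open>y\<close> is allowed.
\<close>

lemma summable_theta:
  fixes p y :: real
  assumes p: "0 < p" "p < 1" and y: "y \<noteq> 0"
  shows "(\<lambda>j::int. y powi j * p powi (j\<^sup>2)) summable_on UNIV"
proof -
  have nat: "(\<lambda>n::nat. y ^ n * p ^ (n\<^sup>2)) summable_on UNIV" if "y \<noteq> 0" for y :: real
  proof -
    have "(\<lambda>n. \<bar>y\<bar> * p ^ (2 * n + 1)) \<longlonglongrightarrow> \<bar>y\<bar> * 0"
    proof (rule tendsto_mult_left)
      have "(\<lambda>n. p * (p\<^sup>2) ^ n) \<longlonglongrightarrow> p * 0"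
        using p by (intro tendsto_mult_left LIMSEQ_power_zero) (auto simp: power_less_one_iff)
      then show "(\<lambda>n. p ^ (2 * n + 1)) \<longlonglongrightarrow> 0" by (simp add: power_mult)
    qed
    then have "eventually (\<lambda>n. \<bar>y\<bar> * p ^ (2 * n + 1) < 1/2) sequentially"
      by (rule order_tendstoD) simp
    then obtain N where N: "\<And>n. n \<ge> N \<Longrightarrow> \<bar>y\<bar> * p ^ (2 * n + 1) < 1/2"
      by (auto simp: eventually_sequentially)
    have "summable (\<lambda>n. \<bar>y\<bar> ^ n * p ^ (n\<^sup>2))"
    proof (rule summable_ratio_test[of "1/2" N])
      fix n assume "n \<ge> N"
      have "(Suc n)\<^sup>2 = n\<^sup>2 + (2 * n + 1)" by (simp add: power2_eq_square)
      then have "norm (\<bar>y\<bar> ^ Suc n * p ^ ((Suc n)\<^sup>2)) = (\<bar>y\<bar> * p ^ (2 * n + 1)) * (\<bar>y\<bar> ^ n * p ^ (n\<^sup>2))"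
        using p by (simp only: power_add) (simp add: abs_mult)
      also have "\<dots> \<le> 1/2 * (\<bar>y\<bar> ^ n * p ^ (n\<^sup>2))"
        using N[OF \<open>n \<ge> N\<close>] p by (intro mult_right_mono) auto
      finally show "norm (\<bar>y\<bar> ^ Suc n * p ^ ((Suc n)\<^sup>2)) \<le> 1/2 * norm (\<bar>y\<bar> ^ n * p ^ (n\<^sup>2))"
        using p by simp
    qed simp
    then have "(\<lambda>n. \<bar>y\<bar> ^ n * p ^ (n\<^sup>2)) summable_on UNIV"
      using p by (intro summable_nonneg_imp_summable_on) auto
    then show ?thesis
      using p by (subst summable_on_iff_abs_summable_on_real) (simp add: abs_mult power_abs)
  qed
  let ?f = "\<lambda>j::int. y powi j * p powi (j\<^sup>2)"
  have sq: "p powi ((int n)\<^sup>2) = p ^ (n\<^sup>2)" for n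
    by (metis of_nat_power power_int_of_nat)
  have "?f summable_on range int"
    using nat[OF y] by (subst summable_on_reindex) (simp_all add: o_def sq)
  moreover have "?f summable_on range (\<lambda>n. - int n)"
    using nat[of "inverse y"] y
    by (subst summable_on_reindex) (simp_all add: o_def sq inj_on_def power_int_minus power_inverse)
  ultimately have "?f summable_on (range int \<union> range (\<lambda>n. - int n))"
    by (rule summable_on_union)
  moreover have "range int \<union> range (\<lambda>n. - int n) = UNIV"
  proof (rule set_eqI)
    fix x show "x \<in> range int \<union> range (\<lambda>n. - int n) \<longleftrightarrow> x \<in> UNIV"
      by (cases x rule: int_cases2) auto
  qed
  ultimately show ?thesis by (simp only:)
qed

definition theta :: "real \<Rightarrow> real \<Rightarrow> real" where
  "theta z p = (\<Sum>\<^sub>\<infinity>j::int. z powi j * p powi (j\<^sup>2))"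

lemma has_sum_theta:
  assumes "0 < p" "p < 1" "z \<noteq> 0"
  shows "((\<lambda>j::int. z powi j * p powi (j\<^sup>2)) has_sum theta z p) UNIV"
  unfolding theta_def using summable_theta[OF assms] by (rule has_sum_infsum)

text \<open>
  Jacobi's triple product is the limit of \<open>finite_triple_product\<close>: both q-factorials in the denominator of each term
  tend to \<open>(p^2; p^2)_\<infinity>\<close>, and Tannery's theorem applies since \<open>inv_qfact\<close> is bounded by its limit.
\<close>

lemma jacobi_triple_product:
  fixes p z :: real
  assumes p: "0 < p" "p < 1" and z: "z \<noteq> 0"
  shows "(\<lambda>n. \<Prod>i<n. (1 + z * p ^ (2 * i + 1)) * (1 + p ^ (2 * i + 1) / z) * (1 - p ^ (2 * i + 2)))
           \<longlonglongrightarrow> theta z p"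
proof -
  define Q where "Q = p\<^sup>2"
  have Q: "0 < Q" "Q < 1" using p by (auto simp: Q_def power_less_one_iff)
  define C where "C = inv_qfact_inf Q"
  have C: "0 < C" using inv_qfact_inf_pos[OF Q] by (simp add: C_def)
  define R where "R = inv_qfact Q"
  have RR: "0 \<le> R a * R b" "R a * R b \<le> C * C" for a b
    using inv_qfact_nonneg[OF Q] inv_qfact_le_inf[OF Q] C
    by (auto intro!: mult_nonneg_nonneg mult_mono simp: C_def R_def)
  have lim: "(\<lambda>n. R (int n)) \<longlonglongrightarrow> C" unfolding C_def R_def by (rule tendsto_inv_qfact[OF Q])
  have limI: "filterlim (\<lambda>n. nat (int n + k)) sequentially sequentially" for k
    unfolding filterlim_at_top
  proof
    fix m
    show "\<forall>\<^sub>F n in sequentially. m \<le> nat (int n + k)"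
      by (rule eventually_sequentiallyI[of "nat (int m - k)"]) linarith
  qed
  have lim': "(\<lambda>n. R (int n + k)) \<longlonglongrightarrow> C" for k
  proof (rule Lim_transform_eventually)
    show "(\<lambda>n. R (int (nat (int n + k)))) \<longlonglongrightarrow> C"
      by (rule filterlim_compose[OF lim limI])
    show "\<forall>\<^sub>F n in sequentially. R (int (nat (int n + k))) = R (int n + k)"
      by (intro eventually_sequentiallyI[of "nat (- k)"]) auto
  qed
  define e where "e j = z powi j" for j
  define P where "P n = (\<Prod>i<n. (1 + z * p ^ (2 * i + 1)) * (1 + p ^ (2 * i + 1) / z))" for n
  have "(\<lambda>n. P n * R (2 * int n)) \<longlonglongrightarrow> theta z p * (C * C)"
  proof (rule tannery_int)
    fix n
    have "e (j - 1) + e (j + 1) = (z + 1 / z) * e j" for j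
      using z by (simp add: e_def power_int_diff power_int_add field_simps power2_eq_square)
    from finite_triple_product[OF p this]
    have "((\<lambda>j. e j * p powi (j\<^sup>2) * (R (int n - j) * R (int n + j))) has_sum
       (e 0 * (\<Prod>i<n. 1 + (z + 1 / z) * p ^ (2 * i + 1) + p ^ (4 * i + 2)) * R (2 * int n))) UNIV"
      by (simp add: R_def Q_def)
    moreover have "(\<Prod>i<n. 1 + (z + 1 / z) * p ^ (2 * i + 1) + p ^ (4 * i + 2)) = P n"
      unfolding P_def
    proof (rule prod.cong)
      fix i
      have "p ^ (4 * i + 2) = p ^ (2 * i + 1) * p ^ (2 * i + 1)"
        unfolding power_add[symmetric] by (rule arg_cong[of _ _ "(^) p"]) simp
      then show "1 + (z + 1 / z) * p ^ (2 * i + 1) + p ^ (4 * i + 2) =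
        (1 + z * p ^ (2 * i + 1)) * (1 + p ^ (2 * i + 1) / z)"
        using z by (simp only:) (simp add: field_simps)
    qed simp
    ultimately show "((\<lambda>j. e j * p powi (j\<^sup>2) * (R (int n - j) * R (int n + j))) has_sum
       (P n * R (2 * int n))) UNIV" by (simp add: e_def)
  next
    show "(\<lambda>j. C * C * (\<bar>z\<bar> powi j * p powi (j\<^sup>2))) summable_on UNIV"
      using p z by (intro summable_on_cmult_right summable_theta) auto
    show "\<bar>e j * p powi (j\<^sup>2) * (R (int n - j) * R (int n + j))\<bar> \<le> C * C * (\<bar>z\<bar> powi j * p powi (j\<^sup>2))" for n j
    proof -
      have "\<bar>e j * p powi (j\<^sup>2) * (R (int n - j) * R (int n + j))\<bar> =
        (R (int n - j) * R (int n + j)) * (\<bar>z\<bar> powi j * p powi (j\<^sup>2))"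
        using RR(1)[of "int n - j" "int n + j"] p unfolding e_def abs_mult[of "_ * _" "R _ * _"]
        by (simp only: abs_of_nonneg) (simp add: abs_mult power_int_abs)
      also have "\<dots> \<le> C * C * (\<bar>z\<bar> powi j * p powi (j\<^sup>2))"
        using RR p by (intro mult_right_mono) auto
      finally show ?thesis .
    qed
    show "((\<lambda>j. e j * p powi (j\<^sup>2) * (C * C)) has_sum theta z p * (C * C)) UNIV"
      unfolding e_def by (rule has_sum_cmult_left[OF has_sum_theta[OF p z]])
    show "(\<lambda>n. e j * p powi (j\<^sup>2) * (R (int n - j) * R (int n + j))) \<longlonglongrightarrow> e j * p powi (j\<^sup>2) * (C * C)" for j
      using lim'[of "-j"] lim'[of j] by (intro tendsto_mult tendsto_const) auto
  qed
  moreover have "(\<lambda>n. R (2 * int n)) \<longlonglongrightarrow> C"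
    using LIMSEQ_subseq_LIMSEQ[OF lim, of "\<lambda>n. 2 * n"] by (simp add: strict_mono_def o_def)
  ultimately have "(\<lambda>n. P n * R (2 * int n) / R (2 * int n) / R (int n)) \<longlonglongrightarrow> theta z p * (C * C) / C / C"
    using C lim by (intro tendsto_divide) auto
  moreover have "P n * R (2 * int n) / R (2 * int n) / R (int n) =
      (\<Prod>i<n. (1 + z * p ^ (2 * i + 1)) * (1 + p ^ (2 * i + 1) / z) * (1 - p ^ (2 * i + 2)))" for n
  proof -
    have ne: "1 - Q ^ i \<noteq> 0" if "i \<ge> 1" for i
      using power_Suc_less_one[of Q "i - 1"] Q that by simp
    have R: "R (int m) = 1 / (\<Prod>i<m. 1 - p ^ (2 * i + 2))" for m
    proof -
      have "(\<Prod>i=1..m. 1 - Q ^ i) = (\<Prod>i<m. 1 - p ^ (2 * i + 2))"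
        using prod.atLeast1_atMost_eq[of "\<lambda>i. 1 - Q ^ i" m]
        by (simp add: Q_def power_mult[symmetric] del: power_Suc)
      then show ?thesis unfolding R_def inv_qfact_of_nat prod_dividef by simp
    qed
    have "R (int m) \<noteq> 0" for m unfolding R_def inv_qfact_of_nat using ne by (auto simp: prod_zero_iff)
    from this[of "2 * n"] have "R (2 * int n) \<noteq> 0" by simp
    then show ?thesis unfolding R[of n] P_def by (simp add: prod.distrib)
  qed
  ultimately show ?thesis using C by simp
qed

section \<open>Summation of the Bailey pair\<close>

text \<open>
  Cauchy's identity, which sorts partitions by their Durfee rectangle of excess \<open>s\<close>. Write \<open>T s\<close> for
  the sum. Comparing terms gives \<open>T s - T (s+1) = - q^(s+1) (T (s+1) - T (s+2))\<close>. Since the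
  \<open>T s\<close> are bounded for \<open>s \<ge> 0\<close>, iterating this forces all differences to vanish. So \<open>T\<close> is constant
  on the natural numbers, and its limit comes from the term \<open>m = 0\<close> alone. Negative
  \<open>s\<close> reduce to positive ones by shifting the summation index.
\<close>

lemma cauchy_durfee:
  fixes q :: real and s :: int
  assumes q: "0 < q" "q < 1"
  shows "((\<lambda>m::int. q powi (m * (m + s)) * (inv_qfact q m * inv_qfact q (m + s))) has_sum
           inv_qfact_inf q) UNIV"
proof -
  define C where "C = inv_qfact_inf q"
  have C: "0 < C" using inv_qfact_inf_pos[OF q] by (simp add: C_def)
  have RR: "0 \<le> inv_qfact q a * inv_qfact q b" "inv_qfact q a * inv_qfact q b \<le> C * C" for a b
    using inv_qfact_nonneg[OF q] inv_qfact_le_inf[OF q] C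
    by (auto intro!: mult_nonneg_nonneg mult_mono simp: C_def)
  define f where "f s m = q powi (m * (m + s)) * (inv_qfact q m * inv_qfact q (m + s))" for s m :: int
  have f0: "0 \<le> f s m" for s m using RR q by (simp add: f_def)
  have summable: "f s summable_on UNIV" for s
  proof (rule summable_on_comparison_test)
    show "(\<lambda>m. (C * C) * ((q powi s) powi m * q powi (m\<^sup>2))) summable_on UNIV"
      using q by (intro summable_on_cmult_right summable_theta) auto
    fix m
    have "q powi (m * (m + s)) = (q powi s) powi m * q powi (m\<^sup>2)"
      using q by (simp add: power_int_mult[symmetric] power_int_add[symmetric] power2_eq_square algebra_simps)
    then show "f s m \<le> (C * C) * ((q powi s) powi m * q powi (m\<^sup>2))"
      using RR(2)[of m "m + s"] q unfolding f_def
      by (subst mult.commute) (auto intro!: mult_right_mono)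
  qed (use f0 in auto)
  define T where "T s = infsum (f s) UNIV" for s
  have T: "(f s has_sum T s) UNIV" for s unfolding T_def using summable by (rule has_sum_infsum)
  have rec: "T s - T (s + 1) = q powi (s + 1) * (T (s + 2) - T (s + 1))" for s
  proof (rule has_sum_unique)
    show "((\<lambda>m. f s m - f (s + 1) m) has_sum (T s - T (s + 1))) UNIV"
      using has_sum_add[OF T[of s] has_sum_uminusI[OF T[of "s + 1"]]] by simp
    have "((\<lambda>m. f (s + 2) (m - 1)) has_sum T (s + 2)) UNIV"
      using has_sum_shift_int[OF T[of "s + 2"], of "-1"] by simp
    from has_sum_cmult_right[OF has_sum_add[OF this has_sum_uminusI[OF T[of "s + 1"]]], of "q powi (s + 1)"]
    have "((\<lambda>m. q powi (s + 1) * (f (s + 2) (m - 1) - f (s + 1) m)) has_sum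
           (q powi (s + 1) * (T (s + 2) - T (s + 1)))) UNIV" by simp
    moreover have "q powi (s + 1) * (f (s + 2) (m - 1) - f (s + 1) m) = f s m - f (s + 1) m" for m
    proof -
      define a b where "a = inv_qfact q m" and "b = inv_qfact q (m + s + 1)"
      define w where "w = q powi (m * (m + s))"
      have A: "inv_qfact q (m - 1) = (1 - q powi m) * a" "inv_qfact q (m + s) = (1 - q powi (m + s + 1)) * b"
        using inv_qfact_pred[OF q, of m] inv_qfact_pred[OF q, of "m + s + 1"] by (auto simp: a_def b_def)
      have P: "q powi ((m - 1) * (m - 1 + (s + 2))) * q powi (s + 1) = w" "q powi (m * (m + (s + 1))) = w * q powi m"
        "q powi (m + s + 1) = q powi m * q powi (s + 1)"
        using q by (auto simp: w_def power_int_add[symmetric] algebra_simps)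
      have "q powi (s + 1) * f (s + 2) (m - 1) = w * ((1 - q powi m) * a * b)"
        unfolding P(1)[symmetric] f_def A[symmetric] b_def by (simp add: algebra_simps)
      moreover have "f (s + 1) m = w * q powi m * (a * b)"
        unfolding f_def P(2) a_def b_def by (simp add: algebra_simps)
      moreover have "f s m = w * (a * ((1 - q powi m * q powi (s + 1)) * b))"
        unfolding f_def A P(3) a_def[symmetric] w_def ..
      ultimately show ?thesis by (simp only: right_diff_distrib) (simp add: algebra_simps)
    qed
    ultimately show "((\<lambda>m. f s m - f (s + 1) m) has_sum
           (q powi (s + 1) * (T (s + 2) - T (s + 1)))) UNIV" by simp
  qed
  have M: "(\<lambda>m::int. C * C * (1 powi m * q powi (m\<^sup>2))) summable_on UNIV"
    using q by (intro summable_on_cmult_right summable_theta) auto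
  define B where "B = infsum (\<lambda>m::int. C * C * (1 powi m * q powi (m\<^sup>2))) UNIV"
  have fM: "f (int s) m \<le> C * C * (1 powi m * q powi (m\<^sup>2))" for s m
  proof (cases "m < 0")
    case True
    then show ?thesis using q C by (simp add: f_def)
  next
    case False
    then have "q powi (m * (m + int s)) \<le> q powi (m\<^sup>2)"
      using q by (intro power_int_decreasing) (auto simp: power2_eq_square algebra_simps)
    then have "f (int s) m \<le> q powi (m\<^sup>2) * (C * C)"
      unfolding f_def by (rule mult_mono) (use RR q in auto)
    also have "\<dots> = C * C * (1 powi m * q powi (m\<^sup>2))" by simp
    finally show ?thesis .
  qed
  have TB: "0 \<le> T (int s)" "T (int s) \<le> B" for s
  proof -
    show "0 \<le> T (int s)" by (rule has_sum_nonneg[OF T]) (rule f0)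
    show "T (int s) \<le> B"
    proof (rule has_sum_mono[OF T])
      show "((\<lambda>m::int. C * C * (1 powi m * q powi (m\<^sup>2))) has_sum B) UNIV"
        unfolding B_def using M by (rule has_sum_infsum)
    qed (rule fM)
  qed
  \<comment> \<open>All D s vanish: they are bounded by B, and D s is at most q^N D (s + N).\<close>
  define D where "D s = \<bar>T (int s) - T (int s + 1)\<bar>" for s
  have D1: "D s \<le> q * D (Suc s)" for s
  proof -
    have "D s = q ^ Suc s * D (Suc s)"
      using rec[of "int s"] q unfolding D_def power_int_of_nat[symmetric]
      by (simp add: abs_mult abs_minus_commute add.commute)
    also have "\<dots> \<le> q ^ 1 * D (Suc s)"
      using q by (intro mult_right_mono power_decreasing) (auto simp: D_def)
    finally show ?thesis by simp
  qed
  have D2: "D s \<le> q ^ N * D (s + N)" for s N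
  proof (induction N)
    case (Suc N)
    have "q ^ N * D (s + N) \<le> q ^ N * (q * D (Suc (s + N)))"
      using D1[of "s + N"] q by (intro mult_left_mono) auto
    then show ?case using Suc by (simp add: algebra_simps)
  qed simp
  have DB: "D s \<le> B" for s
    using TB[of s] TB[of "Suc s"] unfolding D_def of_nat_Suc add.commute[of 1] abs_le_iff by linarith
  have D0: "D s = 0" for s
  proof -
    have lim: "(\<lambda>N. q ^ N * B) \<longlonglongrightarrow> 0 * B"
      using q by (intro tendsto_mult_right LIMSEQ_power_zero) auto
    have "D s \<le> q ^ N * B" for N
    proof -
      have "q ^ N * D (s + N) \<le> q ^ N * B" using q DB by (intro mult_left_mono) auto
      with D2[of s N] show ?thesis by linarith
    qed
    then have "D s \<le> 0 * B" by (intro LIMSEQ_le_const[OF lim] exI[of _ 0]) blast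
    then show ?thesis by (simp add: D_def)
  qed
  have T0: "T (int s) = T 0" for s
  proof (induction s)
    case (Suc s)
    then show ?case using D0[of s] by (simp add: D_def add.commute)
  qed simp
  have "(\<lambda>s. T (int s)) \<longlonglongrightarrow> C"
  proof (rule tannery_int[where f = "\<lambda>s. f (int s)" and g = "\<lambda>j. if j = 0 then C else 0"])
    show "((\<lambda>j::int. if j = 0 then C else 0) has_sum C) UNIV"
      by (rule has_sum_finite_neutralI[of "{0}"]) auto
    fix j :: int
    show "(\<lambda>s. f (int s) j) \<longlonglongrightarrow> (if j = 0 then C else 0)"
    proof (cases j "0 :: int" rule: linorder_cases)
      case less
      then show ?thesis by (simp add: f_def)
    next
      case equal
      then show ?thesis using tendsto_inv_qfact[OF q] by (simp add: f_def C_def)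
    next
      case greater
      have "(\<lambda>s. q ^ s * (C * C)) \<longlonglongrightarrow> 0 * (C * C)"
        using q by (intro tendsto_mult_right LIMSEQ_power_zero) auto
      then have lim: "(\<lambda>s. q ^ s * (C * C)) \<longlonglongrightarrow> 0" by simp
      have le: "f (int s) j \<le> q ^ s * (C * C)" for s
      proof -
        have "int s \<le> j * (j + int s)"
          using greater mult_mono[of 1 j "int s" "j + int s"] by simp
        then have "q powi (j * (j + int s)) \<le> q powi (int s)"
          using q by (intro power_int_decreasing) auto
        then show ?thesis unfolding f_def power_int_of_nat[symmetric] by (rule mult_mono) (use RR q in auto)
      qed
      have "(\<lambda>s. f (int s) j) \<longlonglongrightarrow> 0"
        by (rule tendsto_sandwich[OF _ _ tendsto_const lim]) (simp_all add: f0 le)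
      then show ?thesis using greater by simp
    qed
  next
    show "\<bar>f (int s) m\<bar> \<le> C * C * (1 powi m * q powi (m\<^sup>2))" for s m
      using fM[of s m] f0[of "int s" m] by linarith
  qed (rule M T)+
  then have T0C: "T 0 = C" unfolding T0 by (simp add: LIMSEQ_const_iff)
  have sym: "T (- s) = T s" for s
  proof (rule has_sum_unique)
    show "((\<lambda>m. f (- s) (m + s)) has_sum T (- s)) UNIV"
      by (rule has_sum_shift_int[OF T])
    show "((\<lambda>m. f (- s) (m + s)) has_sum T s) UNIV"
    proof -
      have "f (- s) (m + s) = f s m" for m
        unfolding f_def by (simp add: mult.commute)
      then show ?thesis using T[of s] by simp
    qed
  qed
  have "T s = C"
  proof (cases "s \<ge> 0")
    case True
    then show ?thesis using T0[of "nat s"] T0C by simp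
  next
    case False
    then show ?thesis using T0[of "nat (- s)"] sym[of s] T0C by simp
  qed
  with T[of s] show ?thesis unfolding f_def[abs_def] C_def by (simp only:)
qed

text \<open>
  The sequence \<open>1, 1, 0, -1, -1, 0\<close> continued periodically: the solution of
  \<open>e (j - 1) + e (j + 1) = e j\<close> with \<open>e 0 = 1\<close> and \<open>e (-1) = 0\<close>. It belongs to
  \<open>t = 1\<close> in \<open>finite_triple_product\<close>, that is, to the factors \<open>1 + x + x^2\<close>.
\<close>

definition hexa :: "int \<Rightarrow> real" where
  "hexa j = (if j mod 6 \<in> {0, 1} then 1 else if j mod 6 \<in> {3, 4} then - 1 else 0)"

lemma hexa_periodic: "hexa (6 * k + r) = hexa r"
  by (simp add: hexa_def)

lemma hexa_rec: "hexa (j - 1) + hexa (j + 1) = hexa j"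
proof -
  define k r where "k = j div 6" and "r = j mod 6"
  have "j = 6 * k + r" "0 \<le> r" "r < 6" by (simp_all add: k_def r_def)
  moreover from this have "r = 0 \<or> r = 1 \<or> r = 2 \<or> r = 3 \<or> r = 4 \<or> r = 5" by linarith
  moreover have "hexa (r - 1) + hexa (r + 1) = hexa r"
    using calculation by (elim disjE) (simp_all add: hexa_def)
  ultimately show ?thesis
    using hexa_periodic[of k "r - 1"] hexa_periodic[of k "r + 1"] hexa_periodic[of k r]
    by (simp add: algebra_simps)
qed

lemma abs_hexa_le: "\<bar>hexa j\<bar> \<le> 1"
  by (simp add: hexa_def)

text \<open>
  Expand each term by \<open>finite_triple_product_odd\<close> and exchange the two summations. For fixed \<open>s\<close> the
  sum over \<open>n\<close> is \<open>cauchy_durfee\<close> with excess \<open>2s + 1\<close>, because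
  \<open>n(n + 1) = (n - s)(n + s + 1) + s(s + 1)\<close>.
\<close>

lemma cubic_bailey_sum:
  fixes q :: real
  assumes q: "0 < q" "q < 1" and S: "((\<lambda>s. hexa s * q powi (3 * s\<^sup>2 + 2 * s)) has_sum S) UNIV"
  shows "((\<lambda>n::nat. q ^ (2 * n * (n + 1)) * ((\<Prod>i<n. 1 + q ^ (2 * i + 1) + q ^ (4 * i + 2)) *
             inv_qfact (q\<^sup>2) (2 * int n + 1))) has_sum (inv_qfact_inf (q\<^sup>2) * S)) UNIV"
proof -
  define Q where "Q = q\<^sup>2"
  have Q: "0 < Q" "Q < 1" using q by (auto simp: Q_def power_less_one_iff)
  have Qpow: "Q powi k = q powi (2 * k)" for k by (simp add: Q_def power_int_mult)
  define C where "C = inv_qfact_inf Q"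
  have C: "0 < C" using inv_qfact_inf_pos[OF Q] by (simp add: C_def)
  define R where "R = inv_qfact Q"
  have RR: "0 \<le> R a * R b" "R a * R b \<le> C * C" for a b
    using inv_qfact_nonneg[OF Q] inv_qfact_le_inf[OF Q] C
    by (auto intro!: mult_nonneg_nonneg mult_mono simp: C_def R_def)
  \<comment> \<open>The double series; rows are indexed by n, columns by s.\<close>
  define F where "F = (\<lambda>(n::nat, s::int). hexa s * q powi (s\<^sup>2) *
     (q ^ (2 * n * (n + 1)) * (R (int n - s) * R (int n + s + 1))))"
  have geo: "(\<lambda>n. q ^ n) summable_on UNIV"
    using q by (intro summable_nonneg_imp_summable_on) auto
  have th: "(\<lambda>j::int. 1 powi j * q powi (j\<^sup>2)) summable_on UNIV"
    by (rule summable_theta[OF q]) simp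
  from has_sum_imp_summable[OF has_sum_product_real[OF has_sum_infsum[OF geo] has_sum_infsum[OF th]]]
  have dom: "(\<lambda>x. C * C * (case x of (n, s::int) \<Rightarrow> q ^ n * (1 powi s * q powi (s\<^sup>2)))) summable_on (UNIV \<times> UNIV)"
    by (rule summable_on_cmult_right)
  have le: "norm (F x) \<le> C * C * (case x of (n, s) \<Rightarrow> q ^ n * (1 powi s * q powi (s\<^sup>2)))" for x
  proof -
    obtain n s where x: "x = (n, s)" by (cases x)
    have "q ^ (2 * n * (n + 1)) \<le> q ^ n"
      using q by (intro power_decreasing) auto
    then have a: "q ^ (2 * n * (n + 1)) * (R (int n - s) * R (int n + s + 1)) \<le> q ^ n * (C * C)"
      by (rule mult_mono) (use RR q in auto)
    have b: "\<bar>hexa s\<bar> * q powi (s\<^sup>2) \<le> 1 * q powi (s\<^sup>2)"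
      by (rule mult_right_mono[OF abs_hexa_le]) (use q in auto)
    have "\<bar>hexa s\<bar> * q powi (s\<^sup>2) * (q ^ (2 * n * (n + 1)) * (R (int n - s) * R (int n + s + 1)))
        \<le> 1 * q powi (s\<^sup>2) * (q ^ n * (C * C))"
      by (rule mult_mono[OF b a]) (use q RR in auto)
    moreover have "norm (F x) = \<bar>hexa s\<bar> * q powi (s\<^sup>2) * (q ^ (2 * n * (n + 1)) * (R (int n - s) * R (int n + s + 1)))"
      using q RR(1)[of "int n - s" "int n + s + 1"] unfolding x F_def
      by (simp only: prod.case real_norm_def abs_mult[of "_ * _" "_ * (_ * _)"] abs_mult[of "hexa s"]
            abs_mult[of "q ^ _" "_ * _"] abs_of_nonneg) simp
    ultimately show ?thesis unfolding x by (simp add: mult_ac)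
  qed
  have "F summable_on (UNIV \<times> UNIV)"
    by (subst summable_on_iff_abs_summable_on_real, rule summable_on_comparison_test[OF dom le]) simp
  then obtain W where W: "(F has_sum W) (UNIV \<times> UNIV)" by (auto simp: summable_on_def)
  have rows: "((\<lambda>s. F (n, s)) has_sum (q ^ (2 * n * (n + 1)) * ((\<Prod>i<n. 1 + q ^ (2 * i + 1) + q ^ (4 * i + 2)) *
             R (2 * int n + 1)))) UNIV" for n
  proof -
    have "((\<lambda>j. hexa j * q powi (j\<^sup>2) * (R (int n - j) * R (int n + j + 1))) has_sum
      ((\<Prod>i<n. 1 + q ^ (2 * i + 1) + q ^ (4 * i + 2)) * R (2 * int n + 1))) UNIV"
      using finite_triple_product_odd[OF q, of hexa 1 n] hexa_rec unfolding R_def Q_def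
      by (simp add: hexa_def)
    from has_sum_cmult_right[OF this, of "q ^ (2 * n * (n + 1))"] show ?thesis
      unfolding F_def by (simp only: prod.case mult_ac)
  qed
  have cols: "((\<lambda>n. F (n, s)) has_sum (C * (hexa s * q powi (3 * s\<^sup>2 + 2 * s)))) UNIV" for s
  proof -
    define g where "g = (\<lambda>n. hexa s * q powi (s\<^sup>2) * (Q powi (s * (s + 1)) * (Q powi ((n - s) * (n - s + (2 * s + 1))) *
        (R (n - s) * R (n - s + (2 * s + 1))))))"
    have "(g has_sum (hexa s * q powi (s\<^sup>2) * (Q powi (s * (s + 1)) * C))) UNIV"
      using has_sum_shift_int[OF cauchy_durfee[OF Q, of "2 * s + 1"], of "- s"] unfolding C_def R_def g_def
      by (intro has_sum_cmult_right) simp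
    moreover have "g n = 0" if "n < 0" for n
    proof -
      have "n - s < 0 \<or> n - s + (2 * s + 1) < 0" using that by linarith
      then show ?thesis unfolding g_def R_def by auto
    qed
    ultimately have "((\<lambda>n. g (int n)) has_sum (hexa s * q powi (s\<^sup>2) * (Q powi (s * (s + 1)) * C))) UNIV"
      by (rule has_sum_int_nat)
    moreover have "g (int n) = F (n, s)" for n
    proof -
      have "Q powi (s * (s + 1)) * Q powi ((int n - s) * (int n - s + (2 * s + 1))) = q powi int (2 * n * (n + 1))"
        using q unfolding Qpow by (subst power_int_add[symmetric]) (auto simp: algebra_simps)
      moreover have "int n - s + (2 * s + 1) = int n + s + 1" by simp
      ultimately show ?thesis unfolding g_def F_def power_int_of_nat prod.case
        by (simp only: mult.assoc[symmetric])
    qed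
    moreover have "q powi (s\<^sup>2) * Q powi (s * (s + 1)) = q powi (3 * s\<^sup>2 + 2 * s)"
      using q unfolding Qpow by (subst power_int_add[symmetric]) (auto simp: algebra_simps power2_eq_square)
    ultimately show ?thesis by (simp add: mult_ac)
  qed
  have "((\<lambda>n. q ^ (2 * n * (n + 1)) * ((\<Prod>i<n. 1 + q ^ (2 * i + 1) + q ^ (4 * i + 2)) *
             R (2 * int n + 1))) has_sum W) UNIV"
    by (rule has_sum_SigmaD[OF W rows])
  moreover have "((\<lambda>s. C * (hexa s * q powi (3 * s\<^sup>2 + 2 * s))) has_sum W) UNIV"
    by (rule has_sum_SigmaD[OF W[THEN has_sum_swap[THEN iffD1]]]) (simp add: cols)
  then have "W = C * S" using has_sum_cmult_right[OF S, of C] by (rule has_sum_unique)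
  ultimately show ?thesis by (simp add: C_def R_def Q_def)
qed

section \<open>The quintuple product\<close>

lemma summable_quadratic_powi:
  fixes q c :: real and \<alpha> \<beta> \<gamma> :: int
  assumes q: "0 < q" "q < 1" and c: "c \<noteq> 0" and \<alpha>: "0 < \<alpha>"
  shows "(\<lambda>k::int. c powi k * q powi (\<alpha> * k\<^sup>2 + \<beta> * k + \<gamma>)) summable_on UNIV"
proof -
  have "(\<lambda>k::int. q powi \<gamma> * ((c * q powi \<beta>) powi k * (q powi \<alpha>) powi (k\<^sup>2))) summable_on UNIV"
    using q c \<alpha> powi_less_one[OF q \<alpha>] by (intro summable_on_cmult_right summable_theta) auto
  moreover have "q powi \<gamma> * ((c * q powi \<beta>) powi k * (q powi \<alpha>) powi (k\<^sup>2)) =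
     c powi k * q powi (\<alpha> * k\<^sup>2 + \<beta> * k + \<gamma>)" for k
    using q by (simp add: power_int_add power_int_mult_distrib power_int_mult)
  ultimately show ?thesis by simp
qed

lemma hexa_mult_3: "hexa (3 * k) = (-1) powi k" and hexa_mult_3_1: "hexa (3 * k + 1) = (-1) powi k"
  and hexa_mult_3_2: "hexa (3 * k + 2) = 0"
proof -
  have "(3 * k) mod 6 = (if even k then 0 else 3)" "(3 * k + 1) mod 6 = (if even k then 1 else 4)"
    "(3 * k + 2) mod 6 = (if even k then 2 else 5)"
    by presburger+
  then show "hexa (3 * k) = (-1) powi k" "hexa (3 * k + 1) = (-1) powi k" "hexa (3 * k + 2) = 0"
    by (auto simp: hexa_def power_int_minus_left)
qed

text \<open>
  The pairs \<open>(i, j)\<close> with \<open>i - j\<close> in a fixed class modulo \<open>3\<close> are exactly the pairs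
  \<open>(s + 2k + a, s - k)\<close>, each for one choice of \<open>s\<close> and \<open>k\<close>. The substitution is chosen because
  \<open>(s + 2k)^2 + 2 (s - k)^2 = 3 s^2 + 6 k^2\<close> has no mixed term.
\<close>

lemma has_sum_lattice_coset:
  fixes f g :: "int \<Rightarrow> real" and G :: "int \<times> int \<Rightarrow> real" and a :: int
  assumes f: "(f has_sum x) UNIV" and g: "(g has_sum y) UNIV"
    and G: "\<And>s k. G (s + 2 * k + a, s - k) = f s * g k"
  shows "(G has_sum (x * y)) {(i, j). (i - j) mod 3 = a mod 3}"
proof -
  have "((\<lambda>(s, k). f s * g k) has_sum (x * y)) (UNIV \<times> UNIV)"
    by (rule has_sum_product_real[OF f g])
  also have "?this \<longleftrightarrow> ?thesis"
  proof (rule has_sum_reindex_bij_witness[where j = "\<lambda>(s, k). (s + 2 * k + a, s - k)"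
        and i = "\<lambda>(i, j). (j + (i - j - a) div 3, (i - j - a) div 3)"])
    fix b :: "int \<times> int" assume "b \<in> {(i, j). (i - j) mod 3 = a mod 3}"
    then obtain i j where b: "b = (i, j)" "(i - j) mod 3 = a mod 3" by auto
    then have "3 dvd i - j - a" by (simp add: mod_eq_dvd_iff)
    then obtain k where "i - j - a = 3 * k" ..
    then have "i = j + a + 3 * k" by simp
    then show "(case case b of (i, j) \<Rightarrow> (j + (i - j - a) div 3, (i - j - a) div 3) of
          (s, k) \<Rightarrow> (s + 2 * k + a, s - k)) = b"
      by (simp add: b(1))
  next
    fix b :: "int \<times> int"
    obtain s k where b: "b = (s, k)" by (cases b)
    have d: "s + 2 * k + a - (s - k) - a = 3 * k" by simp
    show "(case case b of (s, k) \<Rightarrow> (s + 2 * k + a, s - k) of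
         (i, j) \<Rightarrow> (j + (i - j - a) div 3, (i - j - a) div 3)) = b"
      by (simp only: b prod.case d) simp
    have "s + 2 * k + a - (s - k) = a + 3 * k" by simp
    then show "(case b of (s, k) \<Rightarrow> (s + 2 * k + a, s - k)) \<in> {(i, j). (i - j) mod 3 = a mod 3}"
      by (simp only: b prod.case mem_Collect_eq) simp
    show "G (case b of (s, k) \<Rightarrow> (s + 2 * k + a, s - k)) = (case b of (s, k) \<Rightarrow> f s * g k)"
      by (simp add: b G)
  qed auto
  finally show ?thesis .
qed

text \<open>
  The product of the two theta functions on the left is a double series whose exponents are
  \<open>9 i^2 + 4 i + 18 j^2 - 10 j\<close>. On the cosets \<open>i - j \<equiv> 0\<close> and \<open>i - j \<equiv> -1\<close> modulo \<open>3\<close> it factors as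
  \<open>D0\<close> and \<open>D1\<close> times the theta function on the right; on the coset of \<open>1\<close> it has the factor \<open>Z\<close>, which
  is \<open>0\<close>. The series in question is \<open>D0 + D1\<close>, the two summands coming from \<open>s \<equiv> 0\<close> and \<open>s \<equiv> 1\<close>
  modulo \<open>3\<close>.
\<close>

lemma quintuple_product_series:
  fixes q :: real
  assumes q: "0 < q" "q < 1"
  obtains S where "((\<lambda>s. hexa s * q powi (3 * s\<^sup>2 + 2 * s)) has_sum S) UNIV"
    and "theta (q ^ 4) (q ^ 9) * theta (- 1 / q ^ 10) (q ^ 18) = S * theta (- (q ^ 18)) (q ^ 54)"
proof -
  define \<epsilon> :: "int \<Rightarrow> real" where "\<epsilon> k = (-1) powi k" for k
  have eps_diff: "\<epsilon> (s - k) = \<epsilon> s * \<epsilon> k" and eps_minus: "\<epsilon> (- k) = \<epsilon> k" and eps_1: "\<epsilon> (- k - 1) = - \<epsilon> k" for s k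
    by (auto simp: \<epsilon>_def power_int_minus_left)
  have quad: "((\<lambda>k. \<epsilon> k * q powi (\<alpha> * k\<^sup>2 + \<beta> * k + \<gamma>)) has_sum
       (\<Sum>\<^sub>\<infinity>k. \<epsilon> k * q powi (\<alpha> * k\<^sup>2 + \<beta> * k + \<gamma>))) UNIV" if "\<alpha> > 0" for \<alpha> \<beta> \<gamma>
    unfolding \<epsilon>_def by (intro has_sum_infsum summable_quadratic_powi q that) simp
  obtain D0 where D0: "((\<lambda>k. \<epsilon> k * q powi (27 * k\<^sup>2 + (-6) * k + 0)) has_sum D0) UNIV"
    by (rule that, rule quad) simp
  obtain D1 where D1: "((\<lambda>k. \<epsilon> k * q powi (27 * k\<^sup>2 + (-24) * k + 5)) has_sum D1) UNIV"
    by (rule that, rule quad) simp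
  obtain X where X: "((\<lambda>k. \<epsilon> k * q powi (27 * k\<^sup>2 + 12 * k + 13)) has_sum X) UNIV"
    by (rule that, rule quad) simp
  obtain Z where Z: "((\<lambda>k. \<epsilon> k * q powi (54 * k\<^sup>2 + 54 * k + 0)) has_sum Z) UNIV"
    by (rule that, rule quad) simp
  \<comment> \<open>The map k to -1 - k preserves k (k + 1) and reverses the sign.\<close>
  have "Z = - Z"
  proof (rule has_sum_unique[OF Z])
    have "((\<lambda>k. \<epsilon> (- k - 1) * q powi (54 * (- k - 1)\<^sup>2 + 54 * (- k - 1) + 0)) has_sum Z) UNIV"
      using has_sum_uminus_int[OF has_sum_shift_int[OF Z, of "-1"]] by simp
    moreover have "54 * (- k - 1)\<^sup>2 + 54 * (- k - 1) = 54 * k\<^sup>2 + 54 * k" for k :: int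
      by (simp add: power2_eq_square algebra_simps)
    ultimately have "((\<lambda>k. - (\<epsilon> k * q powi (54 * k\<^sup>2 + 54 * k + 0))) has_sum Z) UNIV"
      by (simp only: eps_1 mult_minus_left)
    from has_sum_uminusI[OF this] show "((\<lambda>k. \<epsilon> k * q powi (54 * k\<^sup>2 + 54 * k + 0)) has_sum - Z) UNIV"
      by simp
  qed
  then have Z0: "Z = 0" by simp
  define a b c where "a = theta (q ^ 4) (q ^ 9)" and "b = theta (- 1 / q ^ 10) (q ^ 18)"
    and "c = theta (- (q ^ 18)) (q ^ 54)"
  have pw: "0 < q ^ n" "q ^ n < 1" if "n > 0" for n
    using q power_Suc_less_one[of q "n - 1"] that by simp_all
  have pow_powi: "(q ^ n) powi k = q powi (int n * k)" for n k
    by (simp add: power_int_mult)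
  have A: "((\<lambda>i. q powi (9 * i\<^sup>2 + 4 * i)) has_sum a) UNIV"
  proof -
    have "(q ^ 4) powi j * (q ^ 9) powi (j\<^sup>2) = q powi (9 * j\<^sup>2 + 4 * j)" for j
      using q unfolding pow_powi by (simp add: power_int_add)
    moreover have "((\<lambda>j. (q ^ 4) powi j * (q ^ 9) powi (j\<^sup>2)) has_sum a) UNIV"
      unfolding a_def by (rule has_sum_theta) (use q pw in auto)
    ultimately show ?thesis by (simp only:)
  qed
  have B: "((\<lambda>j. \<epsilon> j * q powi (18 * j\<^sup>2 - 10 * j)) has_sum b) UNIV"
  proof -
    have "(- 1 / q ^ 10) powi j * (q ^ 18) powi (j\<^sup>2) = \<epsilon> j * q powi (18 * j\<^sup>2 - 10 * j)" for j
    proof -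
      have "(- 1 / q ^ 10) powi j = \<epsilon> j / q powi (10 * j)"
        unfolding \<epsilon>_def power_int_divide_distrib pow_powi by simp
      then show ?thesis using q unfolding pow_powi by (simp add: power_int_diff)
    qed
    moreover have "((\<lambda>j. (- 1 / q ^ 10) powi j * (q ^ 18) powi (j\<^sup>2)) has_sum b) UNIV"
      unfolding b_def by (rule has_sum_theta) (use q pw in auto)
    ultimately show ?thesis by (simp only:)
  qed
  have C: "((\<lambda>k. \<epsilon> k * q powi (54 * k\<^sup>2 + 18 * k)) has_sum c) UNIV"
  proof -
    have "(- (q ^ 18)) powi j * (q ^ 54) powi (j\<^sup>2) = \<epsilon> j * q powi (54 * j\<^sup>2 + 18 * j)" for j
    proof -
      have "(- (q ^ 18)) powi j = \<epsilon> j * q powi (18 * j)"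
        using power_int_mult_distrib[of "-1" "q ^ 18" j] unfolding \<epsilon>_def pow_powi by simp
      then show ?thesis using q unfolding pow_powi by (simp add: power_int_add)
    qed
    moreover have "((\<lambda>j. (- (q ^ 18)) powi j * (q ^ 54) powi (j\<^sup>2)) has_sum c) UNIV"
      unfolding c_def by (rule has_sum_theta) (use q pw in auto)
    ultimately show ?thesis by (simp only:)
  qed
  have C': "((\<lambda>k. \<epsilon> k * q powi (54 * k\<^sup>2 - 18 * k)) has_sum c) UNIV"
    using has_sum_uminus_int[OF C] by (simp add: eps_minus)
  define G where "G = (\<lambda>(i, j). q powi (9 * i\<^sup>2 + 4 * i) * (\<epsilon> j * q powi (18 * j\<^sup>2 - 10 * j)))"
  have "(G has_sum (a * b)) (UNIV \<times> UNIV)"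
    unfolding G_def by (rule has_sum_product_real[OF A B])
  moreover have "(G has_sum (D0 * c + X * Z + D1 * c)) (UNIV \<times> UNIV)"
  proof -
    have G_eq: "G (i, j) = \<epsilon> j * q powi (9 * i\<^sup>2 + 4 * i + (18 * j\<^sup>2 - 10 * j))" for i j
      using q by (simp add: G_def power_int_add)
    have comb: "\<epsilon> s * q powi x * (\<epsilon> k * q powi y) = \<epsilon> (s - k) * q powi (x + y)" for s k x y
      using q by (simp add: eps_diff power_int_add)
    have "(G has_sum (D0 * c)) {(i, j). (i - j) mod 3 = 0 mod 3}"
      by (rule has_sum_lattice_coset[OF D0 C], unfold G_eq comb)
        (simp add: power2_eq_square algebra_simps)
    moreover have "(G has_sum (X * Z)) {(i, j). (i - j) mod 3 = 1 mod 3}"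
      by (rule has_sum_lattice_coset[OF X Z], unfold G_eq comb)
        (simp add: power2_eq_square algebra_simps)
    moreover have "(G has_sum (D1 * c)) {(i, j). (i - j) mod 3 = (-1) mod 3}"
      by (rule has_sum_lattice_coset[OF D1 C'], unfold G_eq comb)
        (simp add: power2_eq_square algebra_simps)
    ultimately have "(G has_sum (D0 * c + X * Z + D1 * c)) ({(i, j). (i - j) mod 3 = 0 mod 3} \<union>
        {(i, j). (i - j) mod 3 = 1 mod 3} \<union> {(i, j). (i - j) mod 3 = (-1) mod 3})"
      by (intro has_sum_Un_disjoint) auto
    moreover have "{(i, j). (i - j) mod 3 = 0 mod 3} \<union> {(i, j). (i - j) mod 3 = 1 mod 3} \<union>
        {(i, j). (i - j) mod 3 = (-1) mod 3} = (UNIV :: (int \<times> int) set)"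
    proof -
      have "x mod 3 = 0 \<or> x mod 3 = 1 \<or> x mod 3 = 2" for x :: int by presburger
      then show ?thesis by auto
    qed
    ultimately show ?thesis by simp
  qed
  ultimately have "a * b = D0 * c + X * Z + D1 * c" by (rule has_sum_unique)
  then have eq: "a * b = (D0 + D1) * c" by (simp add: Z0 algebra_simps)
  have "((\<lambda>s. hexa s * q powi (3 * s\<^sup>2 + 2 * s)) has_sum (D0 + D1)) UNIV"
  proof -
    let ?f = "\<lambda>s. hexa s * q powi (3 * s\<^sup>2 + 2 * s)"
    have "(?f has_sum D0) (range (\<lambda>k. 3 * (- k)))"
    proof (subst has_sum_reindex)
      have "hexa (3 * - k) * q powi (3 * (3 * - k)\<^sup>2 + 2 * (3 * - k)) = \<epsilon> k * q powi (27 * k\<^sup>2 + (-6) * k + 0)" for k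
        unfolding hexa_mult_3 by (simp add: \<epsilon>_def[symmetric] eps_minus power2_eq_square)
      then show "((?f \<circ> (\<lambda>k. 3 * (- k))) has_sum D0) UNIV"
        using D0 by (simp only: o_def)
    qed (auto intro: injI)
    moreover have "(?f has_sum D1) (range (\<lambda>k. 3 * (- k) + 1))"
    proof (subst has_sum_reindex)
      have "hexa (3 * - k + 1) * q powi (3 * (3 * - k + 1)\<^sup>2 + 2 * (3 * - k + 1)) = \<epsilon> k * q powi (27 * k\<^sup>2 + (-24) * k + 5)" for k
        unfolding hexa_mult_3_1 by (simp add: \<epsilon>_def[symmetric] eps_minus power2_eq_square algebra_simps)
      then show "((?f \<circ> (\<lambda>k. 3 * (- k) + 1)) has_sum D1) UNIV"
        using D1 by (simp only: o_def)
    qed (auto intro: injI)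
    moreover have "3 * (- k) \<noteq> 3 * (- l) + 1" for k l :: int by presburger
    then have "range (\<lambda>k::int. 3 * (- k)) \<inter> range (\<lambda>k. 3 * (- k) + 1) = {}" by auto
    ultimately have "(?f has_sum (D0 + D1)) (range (\<lambda>k. 3 * (- k)) \<union> range (\<lambda>k. 3 * (- k) + 1))"
      by (rule has_sum_Un_disjoint)
    moreover have "?f s = 0" if "s \<notin> range (\<lambda>k. 3 * (- k)) \<union> range (\<lambda>k. 3 * (- k) + 1)" for s
    proof -
      have "s \<noteq> 3 * (- (- (s div 3)))" "s \<noteq> 3 * (- (- (s div 3))) + 1" using that by blast+
      then have "s = 3 * (s div 3) + 2" by presburger
      then show ?thesis using hexa_mult_3_2[of "s div 3"] by simp
    qed
    ultimately show ?thesis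
      by (subst has_sum_cong_neutral[of "range (\<lambda>k. 3 * (- k)) \<union> range (\<lambda>k. 3 * (- k) + 1)" UNIV ?f ?f]) auto
  qed
  with eq show ?thesis using that unfolding a_def b_def c_def by blast
qed

section \<open>Infinite products over residue classes\<close>

text \<open>
  The product over all numbers congruent to \<open>r\<close> modulo \<open>m\<close> and at least \<open>r\<close>, that is
  \<open>(q^r; q^m)_\<infinity>\<close>.
\<close>

definition qprod :: "real \<Rightarrow> nat \<Rightarrow> nat \<Rightarrow> real" where
  "qprod q m r = (\<Prod>i. 1 - q ^ (m * i + r))"

lemma
  assumes q: "0 < q" "q < 1" and m: "0 < m" and r: "0 < r"
  shows tendsto_qprod: "(\<lambda>n. \<Prod>i<n. 1 - q ^ (m * i + r)) \<longlonglongrightarrow> qprod q m r"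
    and qprod_nonzero: "qprod q m r \<noteq> 0"
proof -
  have "summable (\<lambda>i. q ^ r * (q ^ m) ^ i)"
    using q m by (intro summable_mult summable_geometric) (auto simp: power_less_one_iff)
  moreover have "norm ((1 - q ^ (m * i + r)) - 1) = q ^ r * (q ^ m) ^ i" for i
    using q by (simp add: power_add power_mult)
  ultimately have "summable (\<lambda>i. norm ((1 - q ^ (m * i + r)) - 1))" by simp
  then have conv: "convergent_prod (\<lambda>i. 1 - q ^ (m * i + r))"
    by (intro abs_convergent_prod_imp_convergent_prod summable_imp_abs_convergent_prod)
  have "(\<lambda>n. \<Prod>i<Suc n. 1 - q ^ (m * i + r)) \<longlonglongrightarrow> qprod q m r"
    using convergent_prod_LIMSEQ[OF conv] unfolding qprod_def lessThan_Suc_atMost .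
  then show "(\<lambda>n. \<Prod>i<n. 1 - q ^ (m * i + r)) \<longlonglongrightarrow> qprod q m r"
    by (rule LIMSEQ_imp_Suc)
  have "q ^ (m * i + r) < 1" for i
    using q r by (simp add: power_less_one_iff)
  then have "1 - q ^ (m * i + r) \<noteq> 0" for i
    by (metis diff_eq_diff_eq diff_self less_irrefl eq_iff_diff_eq_0)
  then show "qprod q m r \<noteq> 0"
    unfolding qprod_def by (intro prodinf_nonzero[OF conv])
qed

lemma qprod_dissect:
  assumes q: "0 < q" "q < 1" and m: "0 < m" and r: "0 < r" and d: "0 < d"
  shows "qprod q m r = (\<Prod>k<d. qprod q (d * m) (r + k * m))"
proof -
  have "(\<lambda>n. \<Prod>i<d * n. 1 - q ^ (m * i + r)) \<longlonglongrightarrow> qprod q m r"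
    using LIMSEQ_subseq_LIMSEQ[OF tendsto_qprod[OF q m r], of "\<lambda>n. d * n"] d
    by (simp add: strict_mono_def o_def)
  moreover have "(\<lambda>n. \<Prod>k<d. \<Prod>i<n. 1 - q ^ (d * m * i + (r + k * m))) \<longlonglongrightarrow>
      (\<Prod>k<d. qprod q (d * m) (r + k * m))"
    using d m r by (intro tendsto_prod tendsto_qprod q) auto
  moreover have "(\<Prod>i<d * n. 1 - q ^ (m * i + r)) =
      (\<Prod>k<d. \<Prod>i<n. 1 - q ^ (d * m * i + (r + k * m)))" for n
  proof -
    have "(\<Prod>i<n * d. 1 - q ^ (m * i + r)) = (\<Prod>i<n. \<Prod>j=i*d..<i*d+d. 1 - q ^ (m * j + r))"
      by (rule prod.nat_group[symmetric])
    also have "\<dots> = (\<Prod>i<n. \<Prod>k<d. 1 - q ^ (d * m * i + (r + k * m)))"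
    proof (rule prod.cong)
      fix i
      show "(\<Prod>j=i*d..<i*d+d. 1 - q ^ (m * j + r)) = (\<Prod>k<d. 1 - q ^ (d * m * i + (r + k * m)))"
        by (subst prod.atLeastLessThan_shift_0) (simp add: o_def atLeast0LessThan algebra_simps)
    qed simp
    finally show ?thesis by (simp only: mult.commute[of d n] prod.swap[of _ "{..<d}"])
  qed
  ultimately show ?thesis using LIMSEQ_unique by simp
qed

text \<open>
  This is \<open>1 + x = (1 - x^2) / (1 - x)\<close> in every factor.
\<close>

lemma tendsto_qprod_plus:
  assumes q: "0 < q" "q < 1" and m: "0 < m" and r: "0 < r"
  shows "(\<lambda>n. \<Prod>i<n. 1 + q ^ (m * i + r)) \<longlonglongrightarrow> qprod q (2 * m) (2 * r) / qprod q m r"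
proof -
  have "(\<lambda>n. (\<Prod>i<n. 1 - q ^ (2 * m * i + 2 * r)) / (\<Prod>i<n. 1 - q ^ (m * i + r))) \<longlonglongrightarrow>
      qprod q (2 * m) (2 * r) / qprod q m r"
    using m r by (intro tendsto_divide tendsto_qprod qprod_nonzero q) auto
  moreover have "(1 - q ^ (2 * m * i + 2 * r)) / (1 - q ^ (m * i + r)) = 1 + q ^ (m * i + r)" for i
  proof -
    have "q ^ (m * i + r) < 1" using q r by (simp add: power_less_one_iff)
    moreover have "q ^ (2 * m * i + 2 * r) = (q ^ (m * i + r)) ^ 2"
      by (simp add: power_mult[symmetric] algebra_simps)
    ultimately show ?thesis by (simp only:) (simp add: field_simps power2_eq_square)
  qed
  ultimately show ?thesis by (simp only: prod_dividef[symmetric])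
qed

lemma inv_qfact_inf_eq_qprod:
  assumes q: "0 < q" "q < 1"
  shows "inv_qfact_inf (q\<^sup>2) = 1 / qprod q 2 2"
proof (rule LIMSEQ_unique)
  show "(\<lambda>n. inv_qfact (q\<^sup>2) (int n)) \<longlonglongrightarrow> inv_qfact_inf (q\<^sup>2)"
    using q by (intro tendsto_inv_qfact) (auto simp: power_less_one_iff)
  have "(\<lambda>n. 1 / (\<Prod>i<n. 1 - q ^ (2 * i + 2))) \<longlonglongrightarrow> 1 / qprod q 2 2"
    by (intro tendsto_divide tendsto_qprod qprod_nonzero q) auto
  moreover have "inv_qfact (q\<^sup>2) (int n) = 1 / (\<Prod>i<n. 1 - q ^ (2 * i + 2))" for n
    using prod.atLeast1_atMost_eq[of "\<lambda>i. 1 - (q\<^sup>2) ^ i" n]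
    unfolding inv_qfact_of_nat prod_dividef
    by (simp add: power_mult[symmetric] del: power_Suc)
  ultimately show "(\<lambda>n. inv_qfact (q\<^sup>2) (int n)) \<longlonglongrightarrow> 1 / qprod q 2 2" by simp
qed

text \<open>
  Three instances of \<open>jacobi_triple_product\<close>. In the third one, \<open>36\<close>, \<open>72\<close> and \<open>108\<close> modulo \<open>108\<close> together make
  up the multiples of \<open>36\<close> (Euler's pentagonal number theorem).
\<close>

lemma theta_products:
  assumes q: "0 < q" "q < 1"
  shows "theta (q ^ 4) (q ^ 9) =
      qprod q 36 26 / qprod q 18 13 * (qprod q 36 10 / qprod q 18 5) * qprod q 18 18"
    and "theta (- 1 / q ^ 10) (q ^ 18) = qprod q 36 8 * qprod q 36 28 * qprod q 36 36"
    and "theta (- (q ^ 18)) (q ^ 54) = qprod q 36 36"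
proof -
  have p: "0 < q ^ n" "q ^ n < 1" if "n > 0" for n
    using q power_Suc_less_one[of q "n - 1"] that by simp_all
  show "theta (q ^ 4) (q ^ 9) =
      qprod q 36 26 / qprod q 18 13 * (qprod q 36 10 / qprod q 18 5) * qprod q 18 18"
  proof (rule LIMSEQ_unique)
    show "(\<lambda>n. \<Prod>i<n. (1 + q ^ 4 * (q ^ 9) ^ (2 * i + 1)) * (1 + (q ^ 9) ^ (2 * i + 1) / q ^ 4) *
        (1 - (q ^ 9) ^ (2 * i + 2))) \<longlonglongrightarrow> theta (q ^ 4) (q ^ 9)"
      using q by (intro jacobi_triple_product p) auto
    have "(\<lambda>n. (\<Prod>i<n. 1 + q ^ (18 * i + 13)) * (\<Prod>i<n. 1 + q ^ (18 * i + 5)) *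
        (\<Prod>i<n. 1 - q ^ (18 * i + 18))) \<longlonglongrightarrow>
        qprod q (2 * 18) (2 * 13) / qprod q 18 13 * (qprod q (2 * 18) (2 * 5) / qprod q 18 5) * qprod q 18 18"
      by (intro tendsto_mult tendsto_qprod_plus tendsto_qprod q) auto
    moreover have "q ^ 4 * (q ^ 9) ^ (2 * i + 1) = q ^ (18 * i + 13)"
      "(q ^ 9) ^ (2 * i + 1) / q ^ 4 = q ^ (18 * i + 5)" "(q ^ 9) ^ (2 * i + 2) = q ^ (18 * i + 18)" for i
      using q by (simp_all only: power_mult[symmetric] power_add[symmetric] eq_divide_eq divide_eq_eq)
        (simp_all add: algebra_simps flip: power_add)
    ultimately show "(\<lambda>n. \<Prod>i<n. (1 + q ^ 4 * (q ^ 9) ^ (2 * i + 1)) * (1 + (q ^ 9) ^ (2 * i + 1) / q ^ 4) *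
        (1 - (q ^ 9) ^ (2 * i + 2))) \<longlonglongrightarrow>
        qprod q 36 26 / qprod q 18 13 * (qprod q 36 10 / qprod q 18 5) * qprod q 18 18"
      by (simp only: prod.distrib) simp
  qed
  show "theta (- 1 / q ^ 10) (q ^ 18) = qprod q 36 8 * qprod q 36 28 * qprod q 36 36"
  proof (rule LIMSEQ_unique)
    show "(\<lambda>n. \<Prod>i<n. (1 + (- 1 / q ^ 10) * (q ^ 18) ^ (2 * i + 1)) * (1 + (q ^ 18) ^ (2 * i + 1) / (- 1 / q ^ 10)) *
        (1 - (q ^ 18) ^ (2 * i + 2))) \<longlonglongrightarrow> theta (- 1 / q ^ 10) (q ^ 18)"
      using q by (intro jacobi_triple_product p) auto
    have "(\<lambda>n. (\<Prod>i<n. 1 - q ^ (36 * i + 8)) * (\<Prod>i<n. 1 - q ^ (36 * i + 28)) *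
        (\<Prod>i<n. 1 - q ^ (36 * i + 36))) \<longlonglongrightarrow> qprod q 36 8 * qprod q 36 28 * qprod q 36 36"
      by (intro tendsto_mult tendsto_qprod q) auto
    moreover have "1 + (- 1 / q ^ 10) * (q ^ 18) ^ (2 * i + 1) = 1 - q ^ (36 * i + 8)"
      "1 + (q ^ 18) ^ (2 * i + 1) / (- 1 / q ^ 10) = 1 - q ^ (36 * i + 28)"
      "(q ^ 18) ^ (2 * i + 2) = q ^ (36 * i + 36)" for i
    proof -
      have e: "(q ^ 18) ^ (2 * i + 1) = q ^ (36 * i + 8) * q ^ 10"
        unfolding power_mult[symmetric] power_add[symmetric] by (rule arg_cong[of _ _ "(^) q"]) simp
      show "1 + (- 1 / q ^ 10) * (q ^ 18) ^ (2 * i + 1) = 1 - q ^ (36 * i + 8)"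
        unfolding e using q by simp
      have "36 * i + 28 = (36 * i + 8) + (10 + 10)" by simp
      then have "q ^ (36 * i + 28) = q ^ (36 * i + 8) * (q ^ 10 * q ^ 10)" by (simp only: power_add)
      then show "1 + (q ^ 18) ^ (2 * i + 1) / (- 1 / q ^ 10) = 1 - q ^ (36 * i + 28)"
        unfolding e by simp
      show "(q ^ 18) ^ (2 * i + 2) = q ^ (36 * i + 36)"
        unfolding power_mult[symmetric] by (rule arg_cong[of _ _ "(^) q"]) simp
    qed
    ultimately show "(\<lambda>n. \<Prod>i<n. (1 + (- 1 / q ^ 10) * (q ^ 18) ^ (2 * i + 1)) * (1 + (q ^ 18) ^ (2 * i + 1) / (- 1 / q ^ 10)) *
        (1 - (q ^ 18) ^ (2 * i + 2))) \<longlonglongrightarrow> qprod q 36 8 * qprod q 36 28 * qprod q 36 36"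
      by (simp only: prod.distrib)
  qed
  show "theta (- (q ^ 18)) (q ^ 54) = qprod q 36 36"
  proof (rule LIMSEQ_unique)
    show "(\<lambda>n. \<Prod>i<n. (1 + - (q ^ 18) * (q ^ 54) ^ (2 * i + 1)) * (1 + (q ^ 54) ^ (2 * i + 1) / - (q ^ 18)) *
        (1 - (q ^ 54) ^ (2 * i + 2))) \<longlonglongrightarrow> theta (- (q ^ 18)) (q ^ 54)"
      using q by (intro jacobi_triple_product p) auto
    have "(\<lambda>n. (\<Prod>i<n. 1 - q ^ (108 * i + 72)) * (\<Prod>i<n. 1 - q ^ (108 * i + 36)) *
        (\<Prod>i<n. 1 - q ^ (108 * i + 108))) \<longlonglongrightarrow> qprod q 108 72 * qprod q 108 36 * qprod q 108 108"
      by (intro tendsto_mult tendsto_qprod q) auto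
    moreover have "1 + - (q ^ 18) * (q ^ 54) ^ (2 * i + 1) = 1 - q ^ (108 * i + 72)"
      "1 + (q ^ 54) ^ (2 * i + 1) / - (q ^ 18) = 1 - q ^ (108 * i + 36)"
      "(q ^ 54) ^ (2 * i + 2) = q ^ (108 * i + 108)" for i
    proof -
      have e: "(q ^ 54) ^ (2 * i + 1) = q ^ (108 * i + 36) * q ^ 18"
        unfolding power_mult[symmetric] power_add[symmetric] by (rule arg_cong[of _ _ "(^) q"]) simp
      show "1 + (q ^ 54) ^ (2 * i + 1) / - (q ^ 18) = 1 - q ^ (108 * i + 36)"
        unfolding e using q by simp
      have "108 * i + 72 = (108 * i + 36) + (18 + 18)" by simp
      then have "q ^ (108 * i + 72) = q ^ (108 * i + 36) * (q ^ 18 * q ^ 18)" by (simp only: power_add)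
      then show "1 + - (q ^ 18) * (q ^ 54) ^ (2 * i + 1) = 1 - q ^ (108 * i + 72)"
        unfolding e by simp
      show "(q ^ 54) ^ (2 * i + 2) = q ^ (108 * i + 108)"
        unfolding power_mult[symmetric] by (rule arg_cong[of _ _ "(^) q"]) simp
    qed
    moreover have "qprod q 36 36 = qprod q 108 36 * qprod q 108 72 * qprod q 108 108"
      using qprod_dissect[OF q, of 36 36 3] by (simp add: numeral_3_eq_3)
    ultimately show "(\<lambda>n. \<Prod>i<n. (1 + - (q ^ 18) * (q ^ 54) ^ (2 * i + 1)) * (1 + (q ^ 54) ^ (2 * i + 1) / - (q ^ 18)) *
        (1 - (q ^ 54) ^ (2 * i + 2))) \<longlonglongrightarrow> qprod q 36 36"
      by (simp only: prod.distrib mult.commute[of "qprod q 108 72"])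
  qed
qed

text \<open>
  The product \<open>(q^2; q^2)_\<infinity>\<close> in the denominator splits into the nine even classes modulo \<open>18\<close>. The classes
  \<open>8\<close> and \<open>10\<close> modulo \<open>18\<close> split further into \<open>8, 26\<close> and \<open>10, 28\<close> modulo \<open>36\<close>; exactly these, and the class of
  \<open>18\<close>, cancel against the numerator of the quintuple product, which also supplies the
  denominators for \<open>5\<close> and \<open>13\<close>.
\<close>

lemma quintuple_eq_qprod:
  assumes q: "0 < q" "q < 1"
  obtains S where "((\<lambda>s. hexa s * q powi (3 * s\<^sup>2 + 2 * s)) has_sum S) UNIV"
    and "inv_qfact_inf (q\<^sup>2) * S = 1 / (\<Prod>r\<in>{2, 4, 5, 6, 12, 13, 14, 16}. qprod q 18 r)"
proof -
  obtain S where S: "((\<lambda>s. hexa s * q powi (3 * s\<^sup>2 + 2 * s)) has_sum S) UNIV"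
    and eq: "theta (q ^ 4) (q ^ 9) * theta (- 1 / q ^ 10) (q ^ 18) = S * theta (- (q ^ 18)) (q ^ 54)"
    using quintuple_product_series[OF q] .
  note nz = qprod_nonzero[OF q]
  have "qprod q 2 2 = (\<Prod>k<9. qprod q 18 (2 + k * 2))"
    using qprod_dissect[OF q, of 2 2 9] by simp
  also have "\<dots> = qprod q 18 2 * qprod q 18 4 * qprod q 18 6 * qprod q 18 8 * qprod q 18 10 *
      qprod q 18 12 * qprod q 18 14 * qprod q 18 16 * qprod q 18 18"
    by (simp add: lessThan_nat_numeral lessThan_Suc mult_ac numeral_2_eq_2[symmetric])
  finally have d2: "qprod q 2 2 = qprod q 18 2 * qprod q 18 4 * qprod q 18 6 * qprod q 18 8 * qprod q 18 10 *
      qprod q 18 12 * qprod q 18 14 * qprod q 18 16 * qprod q 18 18" .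
  \<comment> \<open>The factors of the classes 8 and 10 modulo 18, each split into two classes modulo 36.\<close>
  define a b where "a = qprod q 36 8 * qprod q 36 26" and "b = qprod q 36 10 * qprod q 36 28"
  have d8: "qprod q 18 8 = a" "qprod q 18 10 = b"
    using qprod_dissect[OF q, of 18 8 2] qprod_dissect[OF q, of 18 10 2]
    by (simp_all add: a_def b_def numeral_2_eq_2)
  have "S * qprod q 36 36 = (a * b * qprod q 18 18 / (qprod q 18 5 * qprod q 18 13)) * qprod q 36 36"
    using eq unfolding theta_products[OF q] a_def b_def by (simp add: mult_ac)
  moreover have "qprod q 36 36 \<noteq> 0" using nz by simp
  ultimately have S_eq: "S = a * b * qprod q 18 18 / (qprod q 18 5 * qprod q 18 13)"
    by (metis mult_right_cancel)
  have ab: "a \<noteq> 0" "b \<noteq> 0" using nz unfolding a_def b_def by simp_all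
  have "inv_qfact_inf (q\<^sup>2) * S = (a * b * qprod q 18 18) / ((a * b * qprod q 18 18) *
      (qprod q 18 2 * qprod q 18 4 * qprod q 18 5 * qprod q 18 6 * qprod q 18 12 * qprod q 18 13 *
       qprod q 18 14 * qprod q 18 16))"
    unfolding inv_qfact_inf_eq_qprod[OF q] d2 d8 S_eq times_divide_times_eq mult_1
    by (rule arg_cong[where f = "\<lambda>x. a * b * qprod q 18 18 / x"]) (simp only: mult_ac)
  also have "\<dots> = 1 / (qprod q 18 2 * qprod q 18 4 * qprod q 18 5 * qprod q 18 6 * qprod q 18 12 *
      qprod q 18 13 * qprod q 18 14 * qprod q 18 16)"
    using ab nz[of 18 18] by simp
  also have "\<dots> = 1 / (\<Prod>r\<in>{2, 4, 5, 6, 12, 13, 14, 16}. qprod q 18 r)"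
    by (simp add: mult.assoc)
  finally have "inv_qfact_inf (q\<^sup>2) * S = 1 / (\<Prod>r\<in>{2, 4, 5, 6, 12, 13, 14, 16}. qprod q 18 r)" .
  with S show ?thesis by (rule that)
qed

section \<open>Generating functions of lists of parts\<close>

text \<open>
  Partitions with parts in \<open>S\<close>, each used a number of times that lies in \<open>M\<close>. The two cases needed
  are \<open>M = UNIV\<close> for ordinary partitions and \<open>M = {0, 1, 2}\<close> for the negative parts.
\<close>

definition lists_with_mults :: "nat set \<Rightarrow> nat set \<Rightarrow> nat list set" where
  "lists_with_mults S M = {xs. sorted_wrt (\<ge>) xs \<and> set xs \<subseteq> S \<and> (\<forall>s\<in>S. count_list xs s \<in> M)}"

lemma count_list_replicate: "count_list (replicate m x) y = (if x = y then m else 0)"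
  by (induction m) auto

lemma sorted_wrt_ge_replicate: "sorted_wrt (\<ge>) (replicate m (x::nat))"
  by (induction m) auto

text \<open>
  The copies of the largest admissible part \<open>t\<close> form an initial segment of a weakly decreasing list.
\<close>

lemma lists_with_mults_insert:
  assumes "\<And>s. s \<in> S \<Longrightarrow> s < t" "0 \<in> M"
  shows "bij_betw (\<lambda>(m, xs). replicate m t @ xs) (M \<times> lists_with_mults S M) (lists_with_mults (insert t S) M)"
proof (rule bij_betwI[where g = "\<lambda>xs. (count_list xs t, dropWhile (\<lambda>x. x = t) xs)"])
  have t: "t \<notin> S" using assms(1) by blast
  show "(\<lambda>(m, xs). replicate m t @ xs) \<in> M \<times> lists_with_mults S M \<rightarrow> lists_with_mults (insert t S) M"
  proof clarify
    fix m xs assume m: "m \<in> M" and xs: "xs \<in> lists_with_mults S M"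
    then have sub: "set xs \<subseteq> S" by (simp add: lists_with_mults_def)
    then have "count_list xs t = 0" using t by (auto simp: count_list_0_iff)
    then have "\<forall>s\<in>insert t S. count_list (replicate m t @ xs) s \<in> M"
      using m xs t by (auto simp: count_list_replicate lists_with_mults_def)
    moreover have "\<forall>y\<in>set xs. y \<le> t" using sub assms(1) less_imp_le by blast
    then have "sorted_wrt (\<ge>) (replicate m t @ xs)"
      using xs by (auto simp: sorted_wrt_append sorted_wrt_ge_replicate lists_with_mults_def)
    ultimately show "replicate m t @ xs \<in> lists_with_mults (insert t S) M"
      using sub unfolding lists_with_mults_def by auto
  qed
  have decomp: "xs = replicate (count_list xs t) t @ dropWhile (\<lambda>x. x = t) xs \<and>
      dropWhile (\<lambda>x. x = t) xs \<in> lists_with_mults S M"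
    if "xs \<in> lists_with_mults (insert t S) M" for xs
  proof -
    define ys zs where "ys = takeWhile (\<lambda>x. x = t) xs" and "zs = dropWhile (\<lambda>x. x = t) xs"
    have xs: "xs = ys @ zs" by (simp add: ys_def zs_def)
    have srt: "sorted_wrt (\<ge>) (ys @ zs)" and sub: "set xs \<subseteq> insert t S" and cnt: "\<forall>s\<in>insert t S. count_list xs s \<in> M"
      using that xs by (auto simp: lists_with_mults_def)
    have ys: "ys = replicate (length ys) t"
      by (rule replicate_eqI) (auto simp: ys_def dest: set_takeWhileD)
    have "t \<notin> set zs"
    proof (cases zs)
      case (Cons z zs')
      then have "z \<noteq> t" using hd_dropWhile[of "\<lambda>x. x = t" xs] by (auto simp: zs_def)
      moreover have "z \<in> insert t S" using sub xs Cons by auto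
      ultimately have "z < t" using assms(1) by auto
      moreover have "\<forall>x\<in>set zs'. x \<le> z" using srt Cons by (auto simp: sorted_wrt_append)
      ultimately show ?thesis using Cons by auto
    qed simp
    moreover have "count_list xs s = count_list ys s + count_list zs s" for s by (simp add: xs)
    moreover have "count_list ys s = (if t = s then length ys else 0)" for s
      by (subst ys) (rule count_list_replicate)
    ultimately have "count_list xs t = length ys" "\<And>s. s \<noteq> t \<Longrightarrow> count_list xs s = count_list zs s"
      by (auto simp: count_list_0_iff)
    note cnt' = this
    have "set zs \<subseteq> S" using sub xs \<open>t \<notin> set zs\<close> by auto
    moreover have "count_list zs s \<in> M" if "s \<in> S" for s
    proof -
      have "s \<noteq> t" using that t by blast
      moreover have "count_list xs s \<in> M" using cnt that by blast
      ultimately show ?thesis using cnt'(2)[of s] by simp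
    qed
    moreover have "sorted_wrt (\<ge>) zs" using srt by (auto simp: sorted_wrt_append)
    ultimately have "zs \<in> lists_with_mults S M" by (simp add: lists_with_mults_def)
    moreover have "xs = replicate (count_list xs t) t @ zs"
      using xs ys cnt'(1) by metis
    ultimately show ?thesis unfolding zs_def by blast
  qed
  show "(\<lambda>xs. (count_list xs t, dropWhile (\<lambda>x. x = t) xs)) \<in> lists_with_mults (insert t S) M \<rightarrow> M \<times> lists_with_mults S M"
    using decomp by (auto simp: lists_with_mults_def)
  show "(case (count_list y t, dropWhile (\<lambda>x. x = t) y) of (m, xs) \<Rightarrow> replicate m t @ xs) = y"
    if "y \<in> lists_with_mults (insert t S) M" for y
    using decomp[OF that] by simp
  show "(\<lambda>xs. (count_list xs t, dropWhile (\<lambda>x. x = t) xs)) (case x of (m, xs) \<Rightarrow> replicate m t @ xs) = x"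
    if x_in: "x \<in> M \<times> lists_with_mults S M" for x
  proof -
    obtain m xs where x: "x = (m, xs)" "set xs \<subseteq> S" using x_in by (auto simp: lists_with_mults_def)
    then have "t \<notin> set xs" using t by auto
    then have "dropWhile (\<lambda>x. x = t) xs = xs" by (cases xs) auto
    then have "dropWhile (\<lambda>x. x = t) (replicate m t @ xs) = xs" by (induction m) auto
    then show ?thesis using x \<open>t \<notin> set xs\<close> by (simp add: count_list_replicate count_list_0_iff)
  qed
qed

text \<open>
  The base \<open>x\<close> may exceed \<open>1\<close> when \<open>M\<close> is finite; the negative parts use \<open>x = 1 / q\<close>.
\<close>

lemma has_sum_lists_with_mults:
  fixes x :: real
  assumes "finite S" "0 \<in> M" and g: "\<And>s. s \<in> S \<Longrightarrow> ((\<lambda>m. x ^ (s * m)) has_sum g s) M"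
  shows "((\<lambda>xs. x ^ sum_list xs) has_sum (\<Prod>s\<in>S. g s)) (lists_with_mults S M)"
  using assms(1) g
proof (induction S rule: finite_linorder_max_induct)
  case empty
  have "lists_with_mults {} M = {[]}" by (auto simp: lists_with_mults_def)
  then show ?case using has_sum_finite[of "{[]}" "\<lambda>xs. x ^ sum_list xs"] by simp
next
  case (insert t S)
  have "((\<lambda>(m, xs). x ^ (t * m) * x ^ sum_list xs) has_sum (g t * (\<Prod>s\<in>S. g s))) (M \<times> lists_with_mults S M)"
  proof (rule has_sum_product_real)
    show "((\<lambda>m. x ^ (t * m)) has_sum g t) M" by (rule insert.prems) simp
    show "((\<lambda>xs. x ^ sum_list xs) has_sum (\<Prod>s\<in>S. g s)) (lists_with_mults S M)"
      by (rule insert.IH, rule insert.prems) simp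
  qed
  moreover have "(\<lambda>(m, xs). x ^ (t * m) * x ^ sum_list xs) = (\<lambda>y. x ^ sum_list (case y of (m, xs) \<Rightarrow> replicate m t @ xs))"
    by (auto simp: fun_eq_iff sum_list_replicate power_add mult.commute)
  ultimately have "((\<lambda>xs. x ^ sum_list xs) has_sum (g t * (\<Prod>s\<in>S. g s))) (lists_with_mults (insert t S) M)"
    using has_sum_reindex_bij_betw[OF lists_with_mults_insert[of S t M], of "\<lambda>xs. x ^ sum_list xs"] insert(2) assms(2)
    by auto
  moreover have "t \<notin> S" using insert(2) by blast
  ultimately show ?case using insert(1) by simp
qed

definition lists_of_length :: "nat \<Rightarrow> nat list set" where
  "lists_of_length l = {xs. sorted_wrt (\<ge>) xs \<and> length xs = l}"

text \<open>
  Subtracting the last, hence least, entry \<open>m\<close> from a list of length \<open>l + 1\<close> leaves a list that ends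
  with \<open>0\<close>, that is, an arbitrary list of length \<open>l\<close>. The weight drops by \<open>(l + 1) m\<close>, which
  gives the factor \<open>1 / (1 - q^(l+1))\<close> of the generating function.
\<close>

lemma lists_of_length_Suc:
  "bij_betw (\<lambda>(m, xs). map (\<lambda>x. x + m) (xs @ [0])) (UNIV \<times> lists_of_length l) (lists_of_length (Suc l))"
proof (rule bij_betwI[where g = "\<lambda>xs. (last xs, map (\<lambda>x. x - last xs) (butlast xs))"])
  show "(\<lambda>(m, xs). map (\<lambda>x. x + m) (xs @ [0])) \<in> UNIV \<times> lists_of_length l \<rightarrow> lists_of_length (Suc l)"
    by (auto simp: lists_of_length_def sorted_wrt_append sorted_wrt_map)
  have ge: "\<forall>x\<in>set (butlast xs). last xs \<le> x" "sorted_wrt (\<ge>) (butlast xs)" "xs \<noteq> []"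
    if "xs \<in> lists_of_length (Suc l)" for xs
  proof -
    show ne: "xs \<noteq> []" using that by (auto simp: lists_of_length_def)
    have "sorted_wrt (\<ge>) (butlast xs @ [last xs])" using that ne by (simp add: lists_of_length_def)
    then show "\<forall>x\<in>set (butlast xs). last xs \<le> x" "sorted_wrt (\<ge>) (butlast xs)"
      by (auto simp: sorted_wrt_append)
  qed
  show "(\<lambda>xs. (last xs, map (\<lambda>x. x - last xs) (butlast xs))) \<in> lists_of_length (Suc l) \<rightarrow> UNIV \<times> lists_of_length l"
  proof
    fix xs assume xs: "xs \<in> lists_of_length (Suc l)"
    have "sorted_wrt (\<lambda>x y. y - last xs \<le> x - last xs) (butlast xs)"
      by (rule sorted_wrt_mono_rel[OF _ ge(2)[OF xs]]) (rule diff_le_mono)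
    then show "(last xs, map (\<lambda>x. x - last xs) (butlast xs)) \<in> UNIV \<times> lists_of_length l"
      using xs by (simp add: lists_of_length_def sorted_wrt_map)
  qed
  show "(case (last y, map (\<lambda>x. x - last y) (butlast y)) of (m, xs) \<Rightarrow> map (\<lambda>x. x + m) (xs @ [0])) = y"
    if "y \<in> lists_of_length (Suc l)" for y
  proof -
    have "map (\<lambda>x. x - last y + last y) (butlast y) = butlast y"
      using ge(1)[OF that] by (intro map_idI) auto
    then show ?thesis using ge(3)[OF that] by (simp add: o_def)
  qed
qed (auto simp: o_def)

lemma has_sum_lists_of_length:
  fixes q :: real
  assumes q: "0 < q" "q < 1"
  shows "((\<lambda>xs. q ^ sum_list xs) has_sum inv_qfact q (int l)) (lists_of_length l)"
proof (induction l)
  case 0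
  have "lists_of_length 0 = {[]}" by (auto simp: lists_of_length_def)
  then show ?case using has_sum_finite[of "{[]}" "\<lambda>xs. q ^ sum_list xs"] by simp
next
  case (Suc l)
  have geo: "((\<lambda>m. r ^ m) has_sum (1 / (1 - r))) UNIV" if "0 < r" "r < 1" for r :: real
    by (rule sums_nonneg_imp_has_sum) (use that geometric_sums[of r] in auto)
  have "((\<lambda>m. (q ^ Suc l) ^ m) has_sum (1 / (1 - q ^ Suc l))) UNIV"
    by (rule geo) (use q power_Suc_less_one[of q l] in auto)
  from has_sum_product_real[OF this Suc]
  have "((\<lambda>(m, xs). (q ^ Suc l) ^ m * q ^ sum_list xs) has_sum (1 / (1 - q ^ Suc l) * inv_qfact q (int l)))
      (UNIV \<times> lists_of_length l)" .
  also have "?this \<longleftrightarrow> ((\<lambda>y. q ^ sum_list (case y of (m, xs) \<Rightarrow> map (\<lambda>x. x + m) (xs @ [0])))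
      has_sum (1 / (1 - q ^ Suc l) * inv_qfact q (int l))) (UNIV \<times> lists_of_length l)"
  proof (rule has_sum_cong)
    fix y :: "nat \<times> nat list" assume "y \<in> UNIV \<times> lists_of_length l"
    then obtain m xs where y: "y = (m, xs)" "length xs = l" by (auto simp: lists_of_length_def)
    have "sum_list (map (\<lambda>x. x + m) (xs @ [0])) = Suc l * m + sum_list xs"
      using y(2) by (simp add: sum_list_addf sum_list_triv)
    then show "(case y of (m, xs) \<Rightarrow> (q ^ Suc l) ^ m * q ^ sum_list xs) =
        q ^ sum_list (case y of (m, xs) \<Rightarrow> map (\<lambda>x. x + m) (xs @ [0]))"
      by (simp only: y prod.case power_add power_mult)
  qed
  finally have "((\<lambda>xs. q ^ sum_list xs) has_sum (1 / (1 - q ^ Suc l) * inv_qfact q (int l))) (lists_of_length (Suc l))"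
    using has_sum_reindex_bij_betw[OF lists_of_length_Suc[of l], of "\<lambda>xs. q ^ sum_list xs"] by simp
  moreover have "1 / (1 - q ^ Suc l) * inv_qfact q (int l) = inv_qfact q (int (Suc l))"
    unfolding inv_qfact_of_nat by simp
  ultimately show ?case by simp
qed

section \<open>Partitions into the given residue classes\<close>

text \<open>
  The classes of \<open>2, 4, 5, 6\<close> and of their negatives modulo \<open>18\<close>.
\<close>

definition residues18 :: "nat set" where
  "residues18 = {2, 4, 5, 6, 12, 13, 14, 16}"

definition partitions18 :: "nat list set" where
  "partitions18 = {\<mu>. sorted_wrt (\<ge>) \<mu> \<and> (\<forall>p\<in>set \<mu>. p mod 18 \<in> residues18)}"

lemma has_sum_partitions18:
  fixes q :: real
  assumes q: "0 < q" "q < 1"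
  shows "((\<lambda>\<mu>. q ^ sum_list \<mu>) has_sum (1 / (\<Prod>r\<in>residues18. qprod q 18 r))) partitions18"
proof -
  define S where "S n = {p. p < 18 * n \<and> p mod 18 \<in> residues18}" for n :: nat
  define B where "B n = lists_with_mults (S n) UNIV" for n
  have r: "r \<in> residues18 \<Longrightarrow> 0 < r \<and> r < 18" for r by (auto simp: residues18_def)
  have S_eq: "S n = (\<lambda>(i, r). 18 * i + r) ` ({..<n} \<times> residues18)" for n
  proof (rule set_eqI)
    fix p :: nat
    have "p = 18 * (p div 18) + p mod 18" by simp
    then have "p \<in> (\<lambda>(i, r). 18 * i + r) ` ({..<n} \<times> residues18)" if "p \<in> S n"
      using that by (intro image_eqI[of _ _ "(p div 18, p mod 18)"]) (auto simp: S_def)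
    moreover have "p \<in> S n" if p: "p \<in> (\<lambda>(i, r). 18 * i + r) ` ({..<n} \<times> residues18)"
    proof -
      obtain i r' where "p = 18 * i + r'" "i < n" "r' \<in> residues18" using p by auto
      moreover from this have "r' < 18" using r by blast
      ultimately show ?thesis by (auto simp: S_def)
    qed
    ultimately show "p \<in> S n \<longleftrightarrow> p \<in> (\<lambda>(i, r). 18 * i + r) ` ({..<n} \<times> residues18)" by blast
  qed
  have inj: "inj_on (\<lambda>(i, r). 18 * i + r) ({..<n} \<times> residues18)" for n
  proof (rule inj_onI, clarify)
    fix i r' j s assume "r' \<in> residues18" "s \<in> residues18" "18 * i + r' = 18 * j + s"
    then have "r' < 18" "s < 18" "18 * i + r' = 18 * j + s" using r by auto
    then show "i = j \<and> r' = s" by presburger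
  qed
  have "((\<lambda>\<mu>. q ^ sum_list \<mu>) has_sum (\<Prod>p\<in>S n. 1 / (1 - q ^ p))) (B n)" for n
    unfolding B_def
  proof (rule has_sum_lists_with_mults)
    show "finite (S n)" by (auto simp: S_def)
    fix p assume "p \<in> S n"
    then have "p > 0" by (auto simp: S_def residues18_def intro: gr0I)
    then have "0 < q ^ p" "q ^ p < 1" using q by (auto simp: power_less_one_iff)
    then have "((\<lambda>m. (q ^ p) ^ m) has_sum (1 / (1 - q ^ p))) UNIV"
      using geometric_sums[of "q ^ p"] by (intro sums_nonneg_imp_has_sum) auto
    then show "((\<lambda>m. q ^ (p * m)) has_sum (1 / (1 - q ^ p))) UNIV" by (simp add: power_mult)
  qed simp
  moreover have "incseq B"
    unfolding B_def lists_with_mults_def S_def by (intro incseq_SucI) fastforce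
  moreover have "(\<lambda>n. \<Prod>p\<in>S n. 1 / (1 - q ^ p)) \<longlonglongrightarrow> (1 / (\<Prod>r\<in>residues18. qprod q 18 r))"
  proof -
    have "(\<Prod>p\<in>S n. 1 - q ^ p) = (\<Prod>r\<in>residues18. \<Prod>i<n. 1 - q ^ (18 * i + r))" for n
    proof -
      have "(\<Prod>p\<in>S n. 1 - q ^ p) = (\<Prod>(i, r)\<in>{..<n} \<times> residues18. 1 - q ^ (18 * i + r))"
        unfolding S_eq prod.reindex[OF inj] by (rule prod.cong) auto
      also have "\<dots> = (\<Prod>i<n. \<Prod>r\<in>residues18. 1 - q ^ (18 * i + r))"
        by (rule prod.cartesian_product[symmetric])
      also have "\<dots> = (\<Prod>r\<in>residues18. \<Prod>i<n. 1 - q ^ (18 * i + r))"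
        by (rule prod.swap)
      finally show ?thesis .
    qed
    then have "(\<Prod>p\<in>S n. 1 / (1 - q ^ p)) = 1 / (\<Prod>r\<in>residues18. \<Prod>i<n. 1 - q ^ (18 * i + r))" for n
      by (simp add: prod_dividef)
    moreover have "(\<lambda>n. 1 / (\<Prod>r\<in>residues18. \<Prod>i<n. 1 - q ^ (18 * i + r))) \<longlonglongrightarrow> 1 / (\<Prod>r\<in>residues18. qprod q 18 r)"
      using r qprod_nonzero[OF q] by (intro tendsto_divide tendsto_prod tendsto_qprod q)
        (auto simp: residues18_def)
    ultimately show ?thesis by simp
  qed
  ultimately have "((\<lambda>\<mu>. q ^ sum_list \<mu>) has_sum (1 / (\<Prod>r\<in>residues18. qprod q 18 r))) (\<Union>n. B n)"
    using q by (intro has_sum_increasing_Union) auto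
  moreover have "(\<Union>n. B n) = partitions18"
  proof
    show "(\<Union>n. B n) \<subseteq> partitions18"
      by (auto simp: B_def lists_with_mults_def S_def partitions18_def)
    show "partitions18 \<subseteq> (\<Union>n. B n)"
    proof
      fix \<mu> assume \<mu>: "\<mu> \<in> partitions18"
      have "p < 18 * Suc (sum_list \<mu>)" if "p \<in> set \<mu>" for p
        using member_le_sum_list[OF that] by simp
      with \<mu> have "\<mu> \<in> B (Suc (sum_list \<mu>))"
        by (auto simp: B_def lists_with_mults_def S_def partitions18_def)
      then show "\<mu> \<in> (\<Union>n. B n)" by blast
    qed
  qed
  ultimately show ?thesis by simp
qed

lemma restricted_partitions_mod18_eq:
  "restricted_partitions_mod18 (int n) = {\<mu> \<in> partitions18. sum_list \<mu> = n}"
proof -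
  have "(\<exists>r\<in>{2, 4, 5, 6}. [int p = r] (mod 18) \<or> [int p = - r] (mod 18)) \<longleftrightarrow> p mod 18 \<in> residues18" for p
  proof -
    have "int p mod 18 = int (p mod 18)" by (simp add: zmod_int)
    then show ?thesis by (auto simp: unique_euclidean_semiring_class.cong_def residues18_def)
  qed
  moreover have "0 < p" if "p mod 18 \<in> residues18" for p
    using that by (auto simp: residues18_def intro: gr0I)
  ultimately show ?thesis
    unfolding restricted_partitions_mod18_def partition_of_def is_partition_def partitions18_def by auto
qed

section \<open>Signed partitions\<close>

text \<open>
  The admissible pairs of all weights, except that the entries of \<open>\<pi>\<close> may be \<open>0\<close>. This only adds the
  pair \<open>([0], [])\<close> of weight \<open>0\<close>, since for \<open>length \<pi> \<ge> 3\<close> the lower bound already forces positive parts; in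
  exchange, the generating function has the same form for all lengths.
\<close>

definition signed_pairs :: "(nat list \<times> nat list) set" where
  "signed_pairs = {(\<pi>, \<nu>). sorted_wrt (\<ge>) \<pi> \<and> is_partition \<nu> \<and> odd (length \<pi>) \<and>
     (\<forall>p\<in>set \<pi>. even p \<and> p \<ge> length \<pi> - 1) \<and>
     (\<forall>m\<in>set \<nu>. odd m \<and> m < length \<pi> \<and> count_list \<nu> m \<le> 2)}"

lemma signed_pairs_bij:
  "bij_betw (\<lambda>(k, xs, \<nu>). (map (\<lambda>x. 2 * x + 2 * k) xs, \<nu>))
     (SIGMA k:UNIV. lists_of_length (2 * k + 1) \<times> lists_with_mults {m. odd m \<and> m < 2 * k + 1} {0, 1, 2})
     signed_pairs"
proof (rule bij_betwI[where g = "\<lambda>(\<pi>, \<nu>). (length \<pi> div 2, map (\<lambda>p. (p - (length \<pi> - 1)) div 2) \<pi>, \<nu>)"], goal_cases)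
  case 1
  show ?case
  proof clarify
    fix k xs \<nu>
    assume xs: "xs \<in> lists_of_length (2 * k + 1)"
      and \<nu>: "\<nu> \<in> lists_with_mults {m. odd m \<and> m < 2 * k + 1} {0, 1, 2}"
    have mem: "odd m \<and> m < 2 * k + 1" if "m \<in> set \<nu>" for m
      using \<nu> that by (auto simp: lists_with_mults_def)
    have "count_list \<nu> m \<le> 2" if "m \<in> set \<nu>" for m
    proof -
      have "count_list \<nu> m \<in> {0, 1, 2}" using \<nu> mem[OF that] by (simp add: lists_with_mults_def)
      then show ?thesis by auto
    qed
    moreover have "is_partition \<nu>"
      using \<nu> mem odd_pos by (auto simp: is_partition_def lists_with_mults_def)
    moreover have "sorted_wrt (\<ge>) (map (\<lambda>x. 2 * x + 2 * k) xs)" "length xs = 2 * k + 1"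
      using xs by (simp_all add: lists_of_length_def sorted_wrt_map)
    ultimately show "(map (\<lambda>x. 2 * x + 2 * k) xs, \<nu>) \<in> signed_pairs"
      using mem by (simp add: signed_pairs_def)
  qed
next
  case 2
  show ?case
  proof (rule Pi_I)
    fix \<sigma> assume \<sigma>: "\<sigma> \<in> signed_pairs"
    obtain \<pi> \<nu> where \<sigma>_eq: "\<sigma> = (\<pi>, \<nu>)" by (cases \<sigma>)
    from \<sigma>[unfolded \<sigma>_eq] have *: "sorted_wrt (\<ge>) \<pi>" "sorted_wrt (\<ge>) \<nu>" "odd (length \<pi>)"
      "\<forall>m\<in>set \<nu>. odd m \<and> m < length \<pi> \<and> count_list \<nu> m \<le> 2"
      by (auto simp: signed_pairs_def is_partition_def)
    have l: "2 * (length \<pi> div 2) + 1 = length \<pi>" using *(3) by simp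
    have "count_list \<nu> m \<in> {0, 1, 2}" for m
      using *(4) by (cases "m \<in> set \<nu>") (force simp: count_list_0_iff)+
    then have "\<nu> \<in> lists_with_mults {m. odd m \<and> m < 2 * (length \<pi> div 2) + 1} {0, 1, 2}"
      unfolding l using * by (auto simp: lists_with_mults_def)
    moreover have "sorted_wrt (\<lambda>x y. (y - (length \<pi> - 1)) div 2 \<le> (x - (length \<pi> - 1)) div 2) \<pi>"
      by (rule sorted_wrt_mono_rel[OF _ *(1)]) (intro div_le_mono diff_le_mono)
    then have "map (\<lambda>p. (p - (length \<pi> - 1)) div 2) \<pi> \<in> lists_of_length (2 * (length \<pi> div 2) + 1)"
      unfolding l by (simp add: lists_of_length_def sorted_wrt_map)
    ultimately show "(case \<sigma> of (\<pi>, \<nu>) \<Rightarrow> (length \<pi> div 2, map (\<lambda>p. (p - (length \<pi> - 1)) div 2) \<pi>, \<nu>)) \<in>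
      (SIGMA k:UNIV. lists_of_length (2 * k + 1) \<times> lists_with_mults {m. odd m \<and> m < 2 * k + 1} {0, 1, 2})"
      by (simp add: \<sigma>_eq)
  qed
next
  case (3 x)
  then show ?case by (auto simp: lists_of_length_def o_def)
next
  case (4 y)
  obtain \<pi> \<nu> where y: "y = (\<pi>, \<nu>)" by (cases y)
  with 4 have *: "odd (length \<pi>)" "\<forall>p\<in>set \<pi>. even p \<and> p \<ge> length \<pi> - 1" by (auto simp: signed_pairs_def)
  have "2 * ((p - (length \<pi> - 1)) div 2) + 2 * (length \<pi> div 2) = p" if "p \<in> set \<pi>" for p
  proof -
    have "even p" "p \<ge> length \<pi> - 1" using * that by auto
    with *(1) show ?thesis by presburger
  qed
  then have "map (\<lambda>p. 2 * ((p - (length \<pi> - 1)) div 2) + 2 * (length \<pi> div 2)) \<pi> = \<pi>"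
    by (intro map_idI)
  then show ?case by (simp add: y o_def)
qed

text \<open>
  Every pair has nonnegative weight, so truncated subtraction of the two sums is the true
  weight.
\<close>

lemma signed_pairs_weight_ge:
  assumes "(\<pi>, \<nu>) \<in> signed_pairs"
  shows "sum_list \<nu> \<le> sum_list \<pi>"
proof -
  from assms have odd: "odd (length \<pi>)" and ge: "\<forall>p\<in>set \<pi>. length \<pi> - 1 \<le> p"
      and neg: "\<forall>m\<in>set \<nu>. odd m \<and> m < length \<pi> \<and> count_list \<nu> m \<le> 2"
    by (auto simp: signed_pairs_def)
  obtain j where j: "length \<pi> = 2 * j + 1" using odd by (auto elim: oddE)
  have "sum_list \<nu> \<le> 2 * j\<^sup>2"
    using neg j by (intro sum_negative_parts_le) auto
  also have "\<dots> \<le> (2 * j + 1) * (2 * j)" by (simp add: power2_eq_square)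
  also have "\<dots> \<le> sum_list \<pi>" using length_le_sum_list[OF ge] j by simp
  finally show ?thesis .
qed

lemma restricted_signed_partitions_eq:
  assumes "n > 0"
  shows "restricted_signed_partitions (int n) =
    {\<sigma> \<in> signed_pairs. sum_list (fst \<sigma>) - sum_list (snd \<sigma>) = n}"
proof (rule set_eqI, clarify)
  fix \<pi> \<nu>
  have "0 < p" if *: "(\<pi>, \<nu>) \<in> signed_pairs" "sum_list \<pi> - sum_list \<nu> = n" "p \<in> set \<pi>" for p
  proof (cases "length \<pi> = 1")
    case True
    then have "\<pi> = [p]" using *(3) by (cases \<pi>) auto
    then show ?thesis using *(2) assms by auto
  next
    case False
    moreover have "length \<pi> \<noteq> 0" "p \<ge> length \<pi> - 1" using *(1,3) by (auto simp: signed_pairs_def)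
    ultimately show ?thesis by linarith
  qed
  then show "(\<pi>, \<nu>) \<in> restricted_signed_partitions (int n) \<longleftrightarrow>
     (\<pi>, \<nu>) \<in> {\<sigma> \<in> signed_pairs. sum_list (fst \<sigma>) - sum_list (snd \<sigma>) = n}"
    using signed_pairs_weight_ge[of \<pi> \<nu>]
    unfolding restricted_signed_partitions_def signed_partition_of_def signed_pairs_def is_partition_def
    by auto
qed

text \<open>
  Clearing the negative powers in \<open>1 + q^-m + q^-2m\<close> for \<open>m = 1, 3, ..., 2k - 1\<close> takes the factor
  \<open>q^(2k^2)\<close>, whose exponent is twice the sum of these \<open>m\<close>.
\<close>

lemma has_sum_odd_parts:
  fixes q :: real
  assumes q: "0 < q"
  shows "((\<lambda>\<nu>. (1 / q) ^ sum_list \<nu>) has_sum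
     ((\<Prod>i<k. 1 + q ^ (2 * i + 1) + q ^ (4 * i + 2)) / q ^ (2 * k\<^sup>2)))
     (lists_with_mults {m. odd m \<and> m < 2 * k + 1} {0, 1, 2})"
proof -
  have "((\<lambda>\<nu>. (1 / q) ^ sum_list \<nu>) has_sum (\<Prod>s\<in>{m. odd m \<and> m < 2 * k + 1}. 1 + (1 / q) ^ s + (1 / q) ^ (2 * s)))
     (lists_with_mults {m. odd m \<and> m < 2 * k + 1} {0, 1, 2})"
  proof (rule has_sum_lists_with_mults)
    show "((\<lambda>m. (1 / q) ^ (s * m)) has_sum (1 + (1 / q) ^ s + (1 / q) ^ (2 * s))) {0, 1, 2}" for s
      by (rule has_sum_finiteI) (simp_all add: mult.commute)
    show "finite {m. odd m \<and> m < 2 * k + 1}"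
      by (rule finite_subset[of _ "{..<2 * k + 1}"]) auto
  qed simp
  moreover have "(\<Prod>s\<in>{m. odd m \<and> m < 2 * k + 1}. 1 + (1 / q) ^ s + (1 / q) ^ (2 * s)) =
      (\<Prod>i<k. 1 + q ^ (2 * i + 1) + q ^ (4 * i + 2)) / q ^ (2 * k\<^sup>2)"
  proof (induction k)
    case 0
    have "{m::nat. odd m \<and> m < 2 * 0 + 1} = {}" by (auto intro: odd_pos)
    then show ?case by (simp only:) simp
  next
    case (Suc k)
    have set: "{m. odd m \<and> m < 2 * Suc k + 1} = insert (2 * k + 1) {m. odd m \<and> m < 2 * k + 1}"
      by (auto simp: less_Suc_eq intro: odd_pos)
    have "1 + (1 / q) ^ (2 * k + 1) + (1 / q) ^ (2 * (2 * k + 1)) =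
        (1 + q ^ (2 * k + 1) + q ^ (4 * k + 2)) / q ^ (4 * k + 2)"
    proof -
      have "q ^ (4 * k + 2) = q ^ (2 * k + 1) * q ^ (2 * k + 1)" "q ^ (2 * (2 * k + 1)) = q ^ (2 * k + 1) * q ^ (2 * k + 1)"
        unfolding power_add[symmetric] by (rule arg_cong[of _ _ "(^) q"], simp)+
      then show ?thesis using q unfolding power_one_over by (simp only:) (simp add: field_simps)
    qed
    moreover have "2 * (Suc k)\<^sup>2 = 2 * k\<^sup>2 + (4 * k + 2)" by (simp add: power2_eq_square)
    then have "q ^ (2 * (Suc k)\<^sup>2) = q ^ (2 * k\<^sup>2) * q ^ (4 * k + 2)" by (simp only: power_add)
    moreover have "finite {m. odd m \<and> m < 2 * k + 1}" by (rule finite_subset[of _ "{..<2 * k + 1}"]) auto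
    ultimately show ?case using Suc unfolding set
      by (subst prod.insert) (simp_all add: mult.commute del: power_Suc)
  qed
  ultimately show ?thesis by simp
qed

text \<open>
  The exponent of \<open>q\<close> in the term for \<open>2k + 1\<close> positive parts is
  \<open>2k (2k + 1) - 2k^2 = 2k (k + 1)\<close>.
\<close>

lemma has_sum_signed_pairs:
  fixes q :: real
  assumes q: "0 < q" "q < 1"
    and V: "((\<lambda>n::nat. q ^ (2 * n * (n + 1)) * ((\<Prod>i<n. 1 + q ^ (2 * i + 1) + q ^ (4 * i + 2)) *
             inv_qfact (q\<^sup>2) (2 * int n + 1))) has_sum V) UNIV"
  shows "((\<lambda>\<sigma>. q ^ (sum_list (fst \<sigma>) - sum_list (snd \<sigma>))) has_sum V) signed_pairs"
proof -
  let ?N = "\<lambda>k. lists_with_mults {m. odd m \<and> m < 2 * k + 1} {0, 1, 2}"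
  let ?A = "SIGMA k:UNIV. lists_of_length (2 * k + 1) \<times> ?N k"
  define f where "f = (\<lambda>(k, xs, \<nu>). q ^ (2 * k * (2 * k + 1)) * ((q\<^sup>2) ^ sum_list xs * (1 / q) ^ sum_list \<nu>))"
  have inner: "((\<lambda>y. f (k, y)) has_sum (q ^ (2 * k * (k + 1)) * ((\<Prod>i<k. 1 + q ^ (2 * i + 1) + q ^ (4 * i + 2)) *
             inv_qfact (q\<^sup>2) (2 * int k + 1)))) (lists_of_length (2 * k + 1) \<times> ?N k)" for k
  proof -
    have "0 < q\<^sup>2" "q\<^sup>2 < 1" using q by (auto simp: power_less_one_iff)
    from has_sum_product_real[OF has_sum_lists_of_length[OF this] has_sum_odd_parts[OF q(1)]]
    have "((\<lambda>(xs, \<nu>). (q\<^sup>2) ^ sum_list xs * (1 / q) ^ sum_list \<nu>) has_sum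
       (inv_qfact (q\<^sup>2) (int (2 * k + 1)) * ((\<Prod>i<k. 1 + q ^ (2 * i + 1) + q ^ (4 * i + 2)) / q ^ (2 * k\<^sup>2))))
       (lists_of_length (2 * k + 1) \<times> ?N k)" .
    from has_sum_cmult_right[OF this, of "q ^ (2 * k * (2 * k + 1))"]
    have "((\<lambda>y. f (k, y)) has_sum (q ^ (2 * k * (2 * k + 1)) * (inv_qfact (q\<^sup>2) (int (2 * k + 1)) *
       ((\<Prod>i<k. 1 + q ^ (2 * i + 1) + q ^ (4 * i + 2)) / q ^ (2 * k\<^sup>2))))) (lists_of_length (2 * k + 1) \<times> ?N k)"
      unfolding f_def by (simp add: case_prod_unfold)
    moreover have "q ^ (2 * k * (2 * k + 1)) = q ^ (2 * k * (k + 1)) * q ^ (2 * k\<^sup>2)"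
      unfolding power_add[symmetric] by (rule arg_cong[of _ _ "(^) q"]) (simp add: power2_eq_square algebra_simps)
    ultimately show ?thesis using q by (simp add: mult_ac add.commute)
  qed
  have "(f has_sum V) ?A"
  proof (rule has_sum_SigmaI[OF inner V])
    show "f summable_on ?A"
      by (rule summable_on_SigmaI[OF inner has_sum_imp_summable[OF V]]) (use q in \<open>auto simp: f_def\<close>)
  qed
  moreover have "f x = (\<lambda>\<sigma>. q ^ (sum_list (fst \<sigma>) - sum_list (snd \<sigma>))) (case x of (k, xs, \<nu>) \<Rightarrow> (map (\<lambda>x. 2 * x + 2 * k) xs, \<nu>))"
    if x: "x \<in> ?A" for x
  proof -
    obtain k xs \<nu> where x': "x = (k, xs, \<nu>)" by (cases x)
    have mem: "(map (\<lambda>x. 2 * x + 2 * k) xs, \<nu>) \<in> signed_pairs"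
      using bij_betwE[OF signed_pairs_bij] x x' by fastforce
    have "length xs = 2 * k + 1" using x x' by (auto simp: lists_of_length_def)
    then have "sum_list (map (\<lambda>x. 2 * x + 2 * k) xs) = 2 * sum_list xs + 2 * k * (2 * k + 1)"
      by (simp add: sum_list_addf sum_list_const_mult sum_list_triv)
    with signed_pairs_weight_ge[OF mem]
    have "q ^ (sum_list (map (\<lambda>x. 2 * x + 2 * k) xs) - sum_list \<nu>) =
        q ^ (2 * sum_list xs + 2 * k * (2 * k + 1)) / q ^ sum_list \<nu>"
      using q by (simp add: power_diff)
    moreover have "f x = q ^ (2 * k * (2 * k + 1)) * (q ^ (2 * sum_list xs) * (1 / q ^ sum_list \<nu>))"
      unfolding x' f_def prod.case power_one_over by (simp only: power_mult)
    ultimately show ?thesis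
      unfolding x' prod.case fst_conv snd_conv by (simp only: power_add) simp
  qed
  ultimately have "((\<lambda>x. (\<lambda>\<sigma>. q ^ (sum_list (fst \<sigma>) - sum_list (snd \<sigma>)))
     (case x of (k, xs, \<nu>) \<Rightarrow> (map (\<lambda>x. 2 * x + 2 * k) xs, \<nu>))) has_sum V) ?A"
    by (subst (asm) has_sum_cong) auto
  then show ?thesis by (subst (asm) has_sum_reindex_bij_betw[OF signed_pairs_bij])
qed

section \<open>Equality of the counts\<close>

theorem theorem4p11:
  fixes n :: int
  assumes "n \<noteq> 0"
  shows "card (restricted_signed_partitions n) = card (restricted_partitions_mod18 n)"
proof (cases "n > 0")
  case True
  define m where "m = nat n"
  have m: "n = int m" "m > 0" using True by (simp_all add: m_def)
  let ?a = "\<lambda>k. real (card {\<sigma> \<in> signed_pairs. sum_list (fst \<sigma>) - sum_list (snd \<sigma>) = k})"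
  let ?b = "\<lambda>k. real (card {\<mu> \<in> partitions18. sum_list \<mu> = k})"
  have "?a m = ?b m"
  proof (rule powser_coeffs_unique[where a = ?a and b = ?b and V = "\<lambda>q. 1 / (\<Prod>r\<in>residues18. qprod q 18 r)"])
    fix q :: real assume q: "0 < q" "q < 1"
    let ?V = "1 / (\<Prod>r\<in>residues18. qprod q 18 r)"
    obtain S where S: "((\<lambda>s. hexa s * q powi (3 * s\<^sup>2 + 2 * s)) has_sum S) UNIV"
      and eq: "inv_qfact_inf (q\<^sup>2) * S = ?V"
      using quintuple_eq_qprod[OF q] unfolding residues18_def .
    show "(\<lambda>k. ?a k * q ^ k) sums ?V"
      by (rule has_sum_fibres_powser[OF has_sum_signed_pairs[OF q cubic_bailey_sum[OF q S, unfolded eq]] q(1)])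
    show "(\<lambda>k. ?b k * q ^ k) sums ?V"
      by (rule has_sum_fibres_powser[OF has_sum_partitions18[OF q] q(1)])
  qed
  then show ?thesis
    unfolding m(1) restricted_signed_partitions_eq[OF m(2)] restricted_partitions_mod18_eq by simp
next
  case False
  then have "n < 0" using assms by simp
  have "\<sigma> \<notin> restricted_signed_partitions n" for \<sigma>
  proof
    assume *: "\<sigma> \<in> restricted_signed_partitions n"
    then have "(fst \<sigma>, snd \<sigma>) \<in> signed_pairs"
      by (auto simp: restricted_signed_partitions_def signed_partition_of_def is_partition_def signed_pairs_def)
    then have "sum_list (snd \<sigma>) \<le> sum_list (fst \<sigma>)" by (rule signed_pairs_weight_ge)
    with * \<open>n < 0\<close> show False
      by (auto simp: restricted_signed_partitions_def signed_partition_of_def)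
  qed
  moreover have "\<mu> \<notin> restricted_partitions_mod18 n" for \<mu>
    using \<open>n < 0\<close> by (auto simp: restricted_partitions_mod18_def partition_of_def)
  ultimately have "restricted_signed_partitions n = {}" "restricted_partitions_mod18 n = {}" by blast+
  then show ?thesis by simp
qed

end
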